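(* Let $F$ be a field, $n \geq 1$, and $L = F[z_1, z_1^{-1}, \ldots, z_n, z_n^{-1}]$. Let $C$ be a bounded chain complex of finitely generated projective $L$-modules. Then $C$ is $F$-finitely dominated if and only if the chain complexes \[ C \otimes_{F[z_j, z_j^{-1}]} F(z_j), \qquad j = 1, 2, \ldots, n, \] are all acyclic, where $F(z_j)$ denotes the field of rational functions in $z_j$.
   Context: $C$ is $F$-finitely dominated if, regarded as a complex of $F$-vector spaces, it is chain homotopy equivalent over $F$ to a bounded complex of finite-dimensional $F$-vector spaces. $C$ is regarded as an $F[z_j,z_j^{-1}]$-module complex by restriction, and $F(z_j)$ is an $F[z_j,z_j^{-1}]$-module via the inclusion into its fraction field. *)

theory Defs
  imports Complex_Main "HOL-Library.Poly_Mapping" "HOL-Library.Function_Algebras"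
    "HOL-Computational_Algebra.Polynomial" "HOL-Computational_Algebra.Fraction_Field"
begin

text \<open>Variables are indexed by a finite type 'n (so n = CARD('n) >= 1).
  A Laurent monomial is an exponent vector 'n => int; L is the monoid ring
  of the group ('n => int) over F, i.e. finitely supported coefficient maps
  with convolution product (library instance of poly_mapping).\<close>

type_synonym ('n, 'a) laurent = "('n \<Rightarrow> int) \<Rightarrow>\<^sub>0 'a"

definition lconst :: "'a::zero \<Rightarrow> ('n, 'a) laurent" where
  "lconst c = Poly_Mapping.single 0 c"

definition laurent_sub :: "'n \<Rightarrow> ('n, 'a::zero) laurent set" where
  "laurent_sub j = {s. \<forall>m \<in> Poly_Mapping.keys s. \<forall>i. i \<noteq> j \<longrightarrow> m i = 0}"

type_synonym 'a ratfun = "'a poly fract"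

definition ratfun_z :: "'a::field ratfun" where
  "ratfun_z = Fract [:0, 1:] 1"

definition laurent_to_ratfun :: "'n \<Rightarrow> ('n, 'a::field) laurent \<Rightarrow> 'a ratfun" where
  "laurent_to_ratfun j s =
     (\<Sum>m \<in> Poly_Mapping.keys s. Fract [:Poly_Mapping.lookup s m:] 1 * ratfun_z powi (m j))"

definition lin_on ::
  "'r set \<Rightarrow> ('r \<Rightarrow> 'b \<Rightarrow> 'b) \<Rightarrow> ('r \<Rightarrow> 'c \<Rightarrow> 'c) \<Rightarrow> 'b set \<Rightarrow> 'c set
     \<Rightarrow> ('b::ab_group_add \<Rightarrow> 'c::ab_group_add) \<Rightarrow> bool" where
  "lin_on R sa sb A B f \<longleftrightarrow>
     (\<forall>x\<in>A. f x \<in> B) \<and> (\<forall>x\<in>A. \<forall>y\<in>A. f (x + y) = f x + f y) \<and>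
     (\<forall>r\<in>R. \<forall>x\<in>A. f (sa r x) = sb r (f x))"

definition submod_on :: "'r set \<Rightarrow> ('r \<Rightarrow> 'b \<Rightarrow> 'b) \<Rightarrow> 'b::ab_group_add set \<Rightarrow> bool" where
  "submod_on R sc A \<longleftrightarrow> 0 \<in> A \<and> (\<forall>x\<in>A. \<forall>y\<in>A. x + y \<in> A) \<and> (\<forall>x\<in>A. - x \<in> A) \<and>
     (\<forall>r\<in>R. \<forall>x\<in>A. sc r x \<in> A)"

definition chain_complex ::
  "('r::comm_ring_1 \<Rightarrow> 'm::ab_group_add \<Rightarrow> 'm) \<Rightarrow> (int \<Rightarrow> 'm set) \<Rightarrow> (int \<Rightarrow> 'm \<Rightarrow> 'm) \<Rightarrow> bool" where
  "chain_complex sc C d \<longleftrightarrow> module sc \<and>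
     (\<forall>k. submod_on UNIV sc (C k)) \<and>
     (\<forall>k. lin_on UNIV sc sc (C k) (C (k - 1)) (d k)) \<and>
     (\<forall>k. \<forall>x \<in> C k. d (k - 1) (d k x) = 0)"

definition bounded_complex :: "(int \<Rightarrow> 'm::zero set) \<Rightarrow> bool" where
  "bounded_complex C \<longleftrightarrow> (\<exists>N. \<forall>k. \<bar>k\<bar> > N \<longrightarrow> C k = {0})"

definition free_mod :: "nat \<Rightarrow> (nat \<Rightarrow> 'r::zero) set" where
  "free_mod m = {v. \<forall>i\<ge>m. v i = 0}"

definition coord_scale :: "'r::times \<Rightarrow> (nat \<Rightarrow> 'r) \<Rightarrow> (nat \<Rightarrow> 'r)" where
  "coord_scale r v = (\<lambda>i. r * v i)"

definition fg_projective ::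
  "('r::comm_ring_1 \<Rightarrow> 'm::ab_group_add \<Rightarrow> 'm) \<Rightarrow> 'm set \<Rightarrow> bool" where
  "fg_projective sc A \<longleftrightarrow> (\<exists>m i p.
     lin_on UNIV sc coord_scale A (free_mod m) i \<and>
     lin_on UNIV coord_scale sc (free_mod m) A p \<and>
     (\<forall>x\<in>A. p (i x) = x))"

text \<open>C (an L-module complex) regarded as a complex of F-vector spaces via the
  constants F in L, is chain homotopy equivalent over F to a bounded complex of
  finite-dimensional F-vector spaces.  Every finite-dimensional F-vector space
  is isomorphic to some F^m, so the target complex D has D k = F^(dim k)
  (realised as free_mod (dim k) in nat => F), with F-linear differentials e.\<close>
definition F_finitely_dominated ::
  "(('n, 'a::field) laurent \<Rightarrow> 'm::ab_group_add \<Rightarrow> 'm) \<Rightarrow> (int \<Rightarrow> 'm set) \<Rightarrow> (int \<Rightarrow> 'm \<Rightarrow> 'm) \<Rightarrow> bool"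
  where
  "F_finitely_dominated sc C d \<longleftrightarrow>
    (let scF = (\<lambda>c::'a. sc (lconst c)); D = (\<lambda>dim k. free_mod (dim k) :: (nat \<Rightarrow> 'a) set) in
     \<exists>(dim :: int \<Rightarrow> nat) (e :: int \<Rightarrow> (nat \<Rightarrow> 'a) \<Rightarrow> (nat \<Rightarrow> 'a))
      (f :: int \<Rightarrow> 'm \<Rightarrow> (nat \<Rightarrow> 'a)) (g :: int \<Rightarrow> (nat \<Rightarrow> 'a) \<Rightarrow> 'm)
      (h :: int \<Rightarrow> 'm \<Rightarrow> 'm) (h' :: int \<Rightarrow> (nat \<Rightarrow> 'a) \<Rightarrow> (nat \<Rightarrow> 'a)).
       \<comment> \<open>D is a bounded complex of finite-dimensional F-vector spaces\<close>
       (\<exists>N. \<forall>k. \<bar>k\<bar> > N \<longrightarrow> dim k = 0) \<and>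
       (\<forall>k. lin_on UNIV coord_scale coord_scale (D dim k) (D dim (k - 1)) (e k)) \<and>
       (\<forall>k. \<forall>y \<in> D dim k. e (k - 1) (e k y) = 0) \<and>
       \<comment> \<open>f : C -> D and g : D -> C are F-linear chain maps\<close>
       (\<forall>k. lin_on UNIV scF coord_scale (C k) (D dim k) (f k)) \<and>
       (\<forall>k. lin_on UNIV coord_scale scF (D dim k) (C k) (g k)) \<and>
       (\<forall>k. \<forall>x \<in> C k. f (k - 1) (d k x) = e k (f k x)) \<and>
       (\<forall>k. \<forall>y \<in> D dim k. g (k - 1) (e k y) = d k (g k y)) \<and>
       \<comment> \<open>F-linear chain homotopies g o f ~ id_C and f o g ~ id_D\<close>
       (\<forall>k. lin_on UNIV scF scF (C k) (C (k + 1)) (h k)) \<and>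
       (\<forall>k. lin_on UNIV coord_scale coord_scale (D dim k) (D dim (k + 1)) (h' k)) \<and>
       (\<forall>k. \<forall>x \<in> C k. x - g k (f k x) = d (k + 1) (h k x) + h (k - 1) (d k x)) \<and>
       (\<forall>k. \<forall>y \<in> D dim k. y - f k (g k y) = e (k + 1) (h' k y) + h' (k - 1) (e k y)))"

text \<open>Constructed as the free abelian group on A \<times> F(z_j) (finitely supported
  int-valued functions) modulo the subgroup generated by the bilinearity and
  balancing relations over S = F[z_j, z_j^-1] (acting on A by restriction of
  the L-action, and on F(z_j) via the inclusion into the fraction field).\<close>

definition tensor_gens :: "'m set \<Rightarrow> ('m \<times> 'a ratfun \<Rightarrow>\<^sub>0 int) set" where
  "tensor_gens A = {u. Poly_Mapping.keys u \<subseteq> A \<times> UNIV}"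

inductive_set tensor_rel ::
  "'n \<Rightarrow> (('n, 'a::field) laurent \<Rightarrow> 'm::ab_group_add \<Rightarrow> 'm) \<Rightarrow> 'm set
     \<Rightarrow> ('m \<times> 'a ratfun \<Rightarrow>\<^sub>0 int) set"
  for j sc A where
  rel_zero: "0 \<in> tensor_rel j sc A"
| rel_add: "u \<in> tensor_rel j sc A \<Longrightarrow> v \<in> tensor_rel j sc A \<Longrightarrow> u + v \<in> tensor_rel j sc A"
| rel_neg: "u \<in> tensor_rel j sc A \<Longrightarrow> - u \<in> tensor_rel j sc A"
| rel_left: "x \<in> A \<Longrightarrow> y \<in> A \<Longrightarrow>
    Poly_Mapping.single (x + y, q) 1 - Poly_Mapping.single (x, q) 1 - Poly_Mapping.single (y, q) 1
      \<in> tensor_rel j sc A"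
| rel_right: "x \<in> A \<Longrightarrow>
    Poly_Mapping.single (x, q + q') 1 - Poly_Mapping.single (x, q) 1 - Poly_Mapping.single (x, q') 1
      \<in> tensor_rel j sc A"
| rel_bal: "x \<in> A \<Longrightarrow> s \<in> laurent_sub j \<Longrightarrow>
    Poly_Mapping.single (sc s x, q) 1 - Poly_Mapping.single (x, laurent_to_ratfun j s * q) 1
      \<in> tensor_rel j sc A"

definition tensor_map :: "('m \<Rightarrow> 'm) \<Rightarrow> ('m \<times> 'q \<Rightarrow>\<^sub>0 int) \<Rightarrow> ('m \<times> 'q \<Rightarrow>\<^sub>0 int)" where
  "tensor_map f u = (\<Sum>p \<in> Poly_Mapping.keys u. Poly_Mapping.single (f (fst p), snd p) (Poly_Mapping.lookup u p))"

definition tensor_acyclic ::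
  "'n \<Rightarrow> (('n, 'a::field) laurent \<Rightarrow> 'm::ab_group_add \<Rightarrow> 'm) \<Rightarrow> (int \<Rightarrow> 'm set) \<Rightarrow> (int \<Rightarrow> 'm \<Rightarrow> 'm) \<Rightarrow> bool"
  where
  "tensor_acyclic j sc C d \<longleftrightarrow>
    (\<forall>k. \<forall>u \<in> tensor_gens (C k).
       tensor_map (d k) u \<in> tensor_rel j sc (C (k - 1)) \<longrightarrow>
       (\<exists>w \<in> tensor_gens (C (k + 1)). u - tensor_map (d (k + 1)) w \<in> tensor_rel j sc (C k)))"

end

theory Submission
  imports Defs
begin

text \<open>
  Since \<open>F(z\<^sub>j)\<close> is a localisation of \<open>S\<^sub>j = F[z\<^sub>j, z\<^sub>j\<^sup>-\<^sup>1]\<close>, acyclicity after tensoring means that every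
  homology class is annihilated by a nonzero element of \<open>S\<^sub>j\<close>.

  If \<open>C\<close> is finitely dominated, a cycle \<open>x\<close> has linearly dependent classes \<open>x, z\<^sub>j x, z\<^sub>j\<^sup>2 x, \<dots>\<close>, which
  gives such an annihilator.

  Conversely, as \<open>C\<close> is bounded and finitely generated projective, annihilators can be collected degree
  by degree to an \<open>L\<close>-linear null-homotopy \<open>h\<^sub>j\<close> of multiplication by some nonzero \<open>p\<^sub>j \<in> S\<^sub>j\<close>.
  Choose a left inverse \<open>q\<^sub>j\<close> of multiplication by \<open>p\<^sub>j\<close> that is linear over the other variables.
  The chain map \<open>T\<^sub>j = 1 - d h\<^sub>j q\<^sub>j - h\<^sub>j q\<^sub>j d\<close> kills \<open>p\<^sub>j C\<close> and commutes with \<open>p\<^sub>i\<close> for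
  \<open>i \<noteq> j\<close>, so the composite of all \<open>T\<^sub>j\<close> factors through the finite-dimensional space
  \<open>C/(p\<^sub>1, \<dots>, p\<^sub>n)C\<close>. It is \<open>F\<close>-homotopic to the identity, hence the homology is finite-dimensional
  over \<open>F\<close>, and over a field \<open>C\<close> is homotopy equivalent to its homology. This avoids
  Noetherianity of \<open>L\<close>.
\<close>

section \<open>Laurent polynomials\<close>

lemma poly_mapping_sum_single:
  fixes s :: "'b \<Rightarrow>\<^sub>0 'c::comm_monoid_add"
  shows "s = (\<Sum>m\<in>Poly_Mapping.keys s. Poly_Mapping.single m (Poly_Mapping.lookup s m))"
  by (rule poly_mapping_eqI)
    (auto simp: lookup_sum lookup_single when_def in_keys_iff sum.delta[OF finite_keys])

text \<open>Monomials suffice as base case: \<open>single m 0\<close> is zero, which starts the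
  induction over the finite sum of monomials.\<close>

lemma poly_mapping_additive_induct [case_names single add]:
  fixes s :: "'b \<Rightarrow>\<^sub>0 'c::comm_monoid_add"
  assumes "\<And>m c. P (Poly_Mapping.single m c)" and "\<And>s t. P s \<Longrightarrow> P t \<Longrightarrow> P (s + t)"
  shows "P s"
proof -
  have "P (\<Sum>m\<in>K. Poly_Mapping.single m (Poly_Mapping.lookup s m))" if "finite K" for K
    using that
  proof induction
    case empty
    show ?case using assms(1)[of _ 0] by simp
  next
    case (insert x F)
    then show ?case using assms by simp
  qed
  from this[OF finite_keys] show ?thesis by (subst poly_mapping_sum_single)
qed

lemma laurent_to_ratfun_single:
  "laurent_to_ratfun j (Poly_Mapping.single m c) = Fract [:c:] 1 * ratfun_z powi (m j)"
  by (cases "c = 0") (auto simp: laurent_to_ratfun_def fract_collapse)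

lemma laurent_to_ratfun_add:
  "laurent_to_ratfun j (s + t) = laurent_to_ratfun j s + laurent_to_ratfun j t"
  for s t :: "('n, 'a::field) laurent"
  unfolding laurent_to_ratfun_def
proof (rule setsum_keys_plus_distrib)
  fix m :: "'n \<Rightarrow> int" and c e :: 'a
  show "Fract [:0::'a:] 1 * ratfun_z powi m j = 0"
    by (simp add: fract_collapse)
  have "Fract [:c + e:] 1 = Fract [:c:] 1 + Fract [:e:] 1" by simp
  then show "Fract [:c + e:] 1 * ratfun_z powi m j
      = Fract [:c:] 1 * ratfun_z powi m j + Fract [:e:] 1 * ratfun_z powi m j"
    by (simp only: distrib_right)
qed

lemma laurent_to_ratfun_0 [simp]: "laurent_to_ratfun j 0 = 0"
  by (simp add: laurent_to_ratfun_def)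

lemma ratfun_z_nonzero: "ratfun_z \<noteq> 0"
  by (simp add: ratfun_z_def Zero_fract_def eq_fract)

lemma laurent_to_ratfun_mult:
  fixes s t :: "('n, 'b::field) laurent"
  shows "laurent_to_ratfun j (s * t) = laurent_to_ratfun j s * laurent_to_ratfun j t"
proof (induction s rule: poly_mapping_additive_induct)
  case (single m c)
  show ?case
  proof (induction t rule: poly_mapping_additive_induct)
    case (single m' c')
    have "Fract [:c * c':] 1 = Fract [:c:] 1 * Fract [:c':] 1" by (simp add: mult.commute)
    moreover have "ratfun_z powi (m j + m' j) = ratfun_z powi (m j) * (ratfun_z powi (m' j) :: 'b ratfun)"
      by (simp add: power_int_add ratfun_z_nonzero)
    ultimately show ?case
      by (simp only: mult_single laurent_to_ratfun_single plus_fun_apply ac_simps)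
  next
    case (add s t)
    then show ?case by (simp add: distrib_left laurent_to_ratfun_add)
  qed
next
  case (add s t)
  then show ?case by (simp add: distrib_right laurent_to_ratfun_add)
qed

lemma laurent_to_ratfun_1 [simp]: "laurent_to_ratfun j 1 = 1"
  by (simp flip: single_one add: laurent_to_ratfun_single One_fract_def one_pCons)

lemma laurent_to_ratfun_sum:
  "laurent_to_ratfun j (sum f A) = (\<Sum>x\<in>A. laurent_to_ratfun j (f x))"
  by (induction A rule: infinite_finite_induct) (auto simp: laurent_to_ratfun_add)

section \<open>Monomials and Laurent polynomials in one of the variables\<close>

definition var_exp :: "'n \<Rightarrow> int \<Rightarrow> 'n \<Rightarrow> int" where
  "var_exp j a = (\<lambda>i. if i = j then a else 0)"

lemma var_exp_add: "var_exp j a + var_exp j b = var_exp j (a + b)"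
  by (auto simp: var_exp_def fun_eq_iff)

lemma var_exp_0 [simp]: "var_exp j 0 = 0"
  by (auto simp: var_exp_def fun_eq_iff)

lemma var_exp_self [simp]: "var_exp j a j = a"
  by (simp add: var_exp_def)

lemma var_exp_inject [simp]: "var_exp j a = var_exp j b \<longleftrightarrow> a = b"
  by (metis var_exp_self)

text \<open>Substitution of the variable z_j for the indeterminate, that is, the embedding of F[X]
  into L with X going to z_j.\<close>

definition laurent_of_poly :: "'n \<Rightarrow> 'a::field poly \<Rightarrow> ('n, 'a) laurent" where
  "laurent_of_poly j P = (\<Sum>i\<le>degree P. Poly_Mapping.single (var_exp j (int i)) (coeff P i))"

lemma laurent_to_ratfun_of_poly: "laurent_to_ratfun j (laurent_of_poly j P) = Fract P 1"
  for P :: "'b::field poly"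
proof -
  have pow: "ratfun_z ^ i = Fract (monom 1 i) 1" for i
    by (induction i) (simp_all add: ratfun_z_def One_fract_def monom_Suc)
  have "Fract [:coeff P i:] 1 * ratfun_z ^ i = Fract (monom (coeff P i) i) 1" for i
    by (simp add: pow smult_monom)
  then have "laurent_to_ratfun j (laurent_of_poly j P) = (\<Sum>i\<le>degree P. Fract (monom (coeff P i) i) 1)"
    by (simp add: laurent_of_poly_def laurent_to_ratfun_sum laurent_to_ratfun_single)
  also have "\<dots> = Fract (\<Sum>i\<le>degree P. monom (coeff P i) i) 1"
  proof -
    have "(\<Sum>i\<in>A. Fract (g i) 1) = Fract (\<Sum>i\<in>A. g i) 1" for A and g :: "nat \<Rightarrow> 'b poly"
      by (induction A rule: infinite_finite_induct) (auto simp: fract_collapse)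
    then show ?thesis .
  qed
  finally show ?thesis by (simp add: poly_as_sum_of_monoms)
qed

lemma laurent_sub_var_exp:
  assumes "s \<in> laurent_sub j" "m \<in> Poly_Mapping.keys s"
  shows "m = var_exp j (m j)"
  using assms by (auto simp: laurent_sub_def var_exp_def fun_eq_iff)

text \<open>The lowest power of z_j is a unit and is split off. What remains is a polynomial with
  nonzero constant term, so that the recurrences it defines later can also be run backwards.\<close>

lemma laurent_sub_factor:
  fixes s :: "('n, 'a::field) laurent"
  assumes s: "s \<in> laurent_sub j" and "s \<noteq> 0"
  obtains a P where "coeff P 0 \<noteq> 0" "s = Poly_Mapping.single (var_exp j a) 1 * laurent_of_poly j P"
proof -
  \<comment> \<open>\<open>K\<close> holds the exponents of z_j occurring in \<open>s\<close>;
    \<open>a\<close> is the smallest of them and \<open>N\<close> the distance to the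
    largest.\<close>
  define K where "K = (\<lambda>m. m j) ` Poly_Mapping.keys s"
  have K: "finite K" "K \<noteq> {}" using \<open>s \<noteq> 0\<close> by (auto simp: K_def)
  define a where "a = Min K"
  define N where "N = nat (Max K - a)"
  define c where "c i = Poly_Mapping.lookup s (var_exp j (a + int i))" for i
  define P where "P = (\<Sum>i\<le>N. monom (c i) i)"
  have coeffP: "coeff P i = (if i \<le> N then c i else 0)" for i
    by (simp add: P_def coeff_sum)
  have "a \<in> K" using K by (simp add: a_def)
  then obtain m where m: "m \<in> Poly_Mapping.keys s" "m j = a" by (auto simp: K_def)
  then have "coeff P 0 \<noteq> 0"
    using laurent_sub_var_exp[OF s m(1)] by (simp add: coeffP c_def in_keys_iff)
  moreover have "s = Poly_Mapping.single (var_exp j a) 1 * laurent_of_poly j P"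
  proof -
    have "laurent_of_poly j P = (\<Sum>i\<le>N. Poly_Mapping.single (var_exp j (int i)) (coeff P i))"
      unfolding laurent_of_poly_def
    proof (rule sum.mono_neutral_left)
      have "degree P \<le> N" by (rule degree_le) (simp add: coeffP)
      then show "{..degree P} \<subseteq> {..N}" by simp
    qed (auto simp: coeff_eq_0)
    then have "Poly_Mapping.single (var_exp j a) 1 * laurent_of_poly j P
        = (\<Sum>i\<le>N. Poly_Mapping.single (var_exp j (a + int i)) (c i))"
      by (simp add: sum_distrib_left mult_single var_exp_add coeffP)
    also have "\<dots> = (\<Sum>m\<in>(\<lambda>i. var_exp j (a + int i)) ` {..N}. Poly_Mapping.single m (Poly_Mapping.lookup s m))"
      by (subst sum.reindex) (auto simp: inj_on_def c_def)
    also have "\<dots> = (\<Sum>m\<in>Poly_Mapping.keys s. Poly_Mapping.single m (Poly_Mapping.lookup s m))"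
    proof (rule sum.mono_neutral_right)
      show "Poly_Mapping.keys s \<subseteq> (\<lambda>i. var_exp j (a + int i)) ` {..N}"
      proof
        fix m assume m: "m \<in> Poly_Mapping.keys s"
        then have "m j \<in> K" by (simp add: K_def)
        then have "a \<le> m j" "m j \<le> Max K" using K by (auto simp: a_def)
        then have "m = var_exp j (a + int (nat (m j - a)))" "nat (m j - a) \<le> N"
          using laurent_sub_var_exp[OF s m] by (auto simp: N_def)
        then show "m \<in> (\<lambda>i. var_exp j (a + int i)) ` {..N}" by blast
      qed
    qed (auto simp: in_keys_iff)
    finally show ?thesis using poly_mapping_sum_single[of s] by simp
  qed
  ultimately show ?thesis by (rule that)
qed

text \<open>A nonzero element is a unit times a nonzero polynomial, and neither factor vanishes in
  F(z_j).\<close>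

lemma laurent_to_ratfun_eq_0_iff:
  fixes s :: "('n, 'a::field) laurent"
  assumes "s \<in> laurent_sub j"
  shows "laurent_to_ratfun j s = 0 \<longleftrightarrow> s = 0"
proof
  assume z: "laurent_to_ratfun j s = 0"
  show "s = 0"
  proof (rule ccontr)
    assume "s \<noteq> 0"
    then obtain a P where P: "coeff P 0 \<noteq> 0"
        "s = Poly_Mapping.single (var_exp j a) 1 * laurent_of_poly j P"
      using laurent_sub_factor[OF assms] by metis
    then have "Fract [:1:] 1 * ratfun_z powi a * Fract P 1 = 0"
      using z by (simp add: laurent_to_ratfun_mult laurent_to_ratfun_of_poly laurent_to_ratfun_single)
    moreover have "P \<noteq> 0" using P by auto
    then have "Fract P 1 \<noteq> 0" by (simp add: Zero_fract_def eq_fract)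
    moreover have "Fract [:1::'a:] 1 \<noteq> 0" by (simp add: Zero_fract_def eq_fract)
    ultimately show False
      by (simp add: ratfun_z_nonzero)
  qed
qed simp

lemma laurent_sub_single: "Poly_Mapping.single (var_exp j a) c \<in> laurent_sub j"
  by (auto simp: laurent_sub_def var_exp_def)

lemma laurent_sub_0: "0 \<in> laurent_sub j"
  by (simp add: laurent_sub_def)

lemma laurent_sub_lconst: "lconst c \<in> laurent_sub j"
  using laurent_sub_single[of j 0 c] by (simp add: lconst_def)

lemma laurent_sub_1: "1 \<in> laurent_sub j"
  by (simp flip: single_one lconst_def add: laurent_sub_lconst)

lemma laurent_sub_uminus: "s \<in> laurent_sub j \<Longrightarrow> - s \<in> laurent_sub j"
  by (simp add: laurent_sub_def)

lemma laurent_sub_add: "s \<in> laurent_sub j \<Longrightarrow> t \<in> laurent_sub j \<Longrightarrow> s + t \<in> laurent_sub j"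
  using keys_add[of s t] by (fastforce simp: laurent_sub_def)

lemma laurent_sub_diff:
  "s \<in> laurent_sub j \<Longrightarrow> t \<in> laurent_sub j \<Longrightarrow> s - t \<in> laurent_sub j" for s t :: "('n, 'a::field) laurent"
  using laurent_sub_add[OF _ laurent_sub_uminus] by fastforce

lemma laurent_sub_mult:
  "s \<in> laurent_sub j \<Longrightarrow> t \<in> laurent_sub j \<Longrightarrow> s * t \<in> laurent_sub j"
  for s t :: "('n, 'a::field) laurent"
  using keys_mult[of s t] by (fastforce simp: laurent_sub_def)

lemma laurent_sub_sum:
  "(\<And>x. x \<in> A \<Longrightarrow> f x \<in> laurent_sub j) \<Longrightarrow> sum f A \<in> laurent_sub j"
  for f :: "_ \<Rightarrow> ('n, 'a::field) laurent"
  by (induction A rule: infinite_finite_induct) (auto simp: laurent_sub_0 laurent_sub_add)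

lemma laurent_sub_of_int: "(of_int n :: ('n, 'a::field) laurent) \<in> laurent_sub j"
  using laurent_sub_lconst[of "of_int n :: 'a"] by (simp add: lconst_def)

lemma laurent_sub_of_poly: "laurent_of_poly j P \<in> laurent_sub j"
  unfolding laurent_of_poly_def by (intro laurent_sub_sum laurent_sub_single)

lemma laurent_to_ratfun_inj_on: "inj_on (laurent_to_ratfun j) (laurent_sub j)"
proof (rule inj_onI)
  fix s t :: "('a, 'b) laurent"
  assume st: "s \<in> laurent_sub j" "t \<in> laurent_sub j" "laurent_to_ratfun j s = laurent_to_ratfun j t"
  have "laurent_to_ratfun j (s - t) + laurent_to_ratfun j t = laurent_to_ratfun j s"
    by (simp flip: laurent_to_ratfun_add)
  then show "s = t"
    using laurent_to_ratfun_eq_0_iff[OF laurent_sub_diff[OF st(1,2)]] st(3) by simp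
qed

text \<open>The absence of zero divisors is pulled back from the field F(z_j) along the
  embedding.\<close>

lemma laurent_sub_mult_nonzero:
  fixes s t :: "('n, 'a::field) laurent"
  assumes "s \<in> laurent_sub j" "t \<in> laurent_sub j" "s \<noteq> 0" "t \<noteq> 0"
  shows "s * t \<noteq> 0"
  using laurent_to_ratfun_eq_0_iff[OF assms(1)] laurent_to_ratfun_eq_0_iff[OF assms(2)] assms(3,4)
    laurent_to_ratfun_mult[of j s t] by auto

lemma ratfun_clear_denominator:
  obtains s where "s \<in> laurent_sub j" "s \<noteq> 0" "laurent_to_ratfun j s * q \<in> laurent_to_ratfun j ` laurent_sub j"
proof (cases q)
  case (Fract a b)
  have "laurent_to_ratfun j (laurent_of_poly j b) * q = laurent_to_ratfun j (laurent_of_poly j a)"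
    using Fract by (simp add: laurent_to_ratfun_of_poly eq_fract)
  moreover have "laurent_of_poly j b \<noteq> 0"
    using Fract laurent_to_ratfun_of_poly[of j b] by (auto simp: Zero_fract_def eq_fract)
  ultimately show ?thesis
    using that[of "laurent_of_poly j b"] laurent_sub_of_poly by (metis imageI)
qed

section \<open>Division by a Laurent polynomial in one variable\<close>

lemma lconst_mult: "lconst (c * e) = lconst c * lconst e" for c :: "'a::field"
  by (simp add: lconst_def mult_single)

lemma lconst_add: "lconst (c + e) = lconst c + lconst e" for c :: "'a::field"
  by (simp add: lconst_def single_add)

lemma lconst_1: "lconst 1 = 1"
  by (simp add: lconst_def)

lemma single_eq_lconst_mult: "Poly_Mapping.single m c = lconst c * Poly_Mapping.single m 1"
  for c :: "'a::field"
  by (simp add: lconst_def mult_single)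

lemma vector_space_lconst:
  assumes "module sc"
  shows "vector_space (\<lambda>c::'a::field. sc (lconst c))"
proof -
  interpret module sc by (rule assms)
  show ?thesis
    by unfold_locales (simp_all add: lconst_mult lconst_add lconst_1 scale_left_distrib scale_right_distrib)
qed

text \<open>Multiplication by \<open>s\<close> is an injective F-linear map on F[z_j, z_j^-1], so it
  has an F-linear left inverse \<open>r\<close> there. As L is free over F[z_j, z_j^-1] on the
  monomials in the other variables, \<open>r\<close> extends to L linearly over those
  variables.\<close>

lemma laurent_division:
  fixes s :: "('n, 'a::field) laurent"
  assumes s: "s \<in> laurent_sub j" "s \<noteq> 0"
  obtains Q where "\<And>u v. Q (u + v) = Q u + Q v"
    "\<And>t u. (\<forall>m\<in>Poly_Mapping.keys t. m j = 0) \<Longrightarrow> Q (t * u) = t * Q u"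
    "\<And>u. Q (s * u) = u"
proof -
  have mod: "module ((*) :: ('n, 'a) laurent \<Rightarrow> _)"
    by unfold_locales (simp_all add: algebra_simps)
  interpret L: vector_space "\<lambda>c. (*) (lconst c :: ('n, 'a) laurent)"
    by (rule vector_space_lconst[OF mod])
  interpret LL: vector_space_pair "\<lambda>c. (*) (lconst c :: ('n, 'a) laurent)" "\<lambda>c. (*) (lconst c :: ('n, 'a) laurent)"
    by unfold_locales
  have lin: "Vector_Spaces.linear (\<lambda>c. (*) (lconst c :: ('n, 'a) laurent)) (\<lambda>c. (*) (lconst c :: ('n, 'a) laurent)) ((*) s)"
    by unfold_locales (simp_all add: algebra_simps)
  have sub: "L.subspace (laurent_sub j)"
    by (simp add: L.subspace_def laurent_sub_0 laurent_sub_add laurent_sub_mult laurent_sub_lconst)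
  have inj: "inj_on ((*) s) (laurent_sub j)"
  proof (rule inj_onI)
    fix u v assume uv: "u \<in> laurent_sub j" "v \<in> laurent_sub j" "s * u = s * v"
    then have "s * (u - v) = 0" by (simp add: right_diff_distrib)
    then have "u - v = 0" using laurent_sub_mult_nonzero[OF s(1) laurent_sub_diff[OF uv(1,2)] s(2)] by blast
    then show "u = v" by simp
  qed
  obtain r where r: "Vector_Spaces.linear (\<lambda>c. (*) (lconst c :: ('n, 'a) laurent)) (\<lambda>c. (*) (lconst c :: ('n, 'a) laurent)) r"
    and rs: "\<forall>v\<in>laurent_sub j. r (s * v) = v"
    using LL.linear_exists_left_inverse_on[OF lin sub inj] by (elim exE conjE) (rule that)
  interpret r: Vector_Spaces.linear "\<lambda>c. (*) (lconst c :: ('n, 'a) laurent)" "\<lambda>c. (*) (lconst c :: ('n, 'a) laurent)" r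
    by (rule r)
  \<comment> \<open>Each monomial is split as \<open>m(j := 0)\<close> times a power of z_j, and
    \<open>r\<close> acts on the second factor only.\<close>
  define Q where "Q u = (\<Sum>m\<in>Poly_Mapping.keys u. Poly_Mapping.single (m(j := 0)) (Poly_Mapping.lookup u m)
    * r (Poly_Mapping.single (var_exp j (m j)) 1))" for u
  have Q_add: "Q (u + v) = Q u + Q v" for u v
    unfolding Q_def by (rule setsum_keys_plus_distrib) (simp_all add: single_add distrib_right)
  have Q_single: "Q (Poly_Mapping.single m c) = Poly_Mapping.single (m(j := 0)) c
      * r (Poly_Mapping.single (var_exp j (m j)) 1)" for m c
    by (cases "c = 0") (simp_all add: Q_def)
  have Q0: "Q 0 = 0" by (simp add: Q_def)
  have Q_sum: "Q (sum f I) = (\<Sum>i\<in>I. Q (f i))" for f and I :: "('n \<Rightarrow> int) set"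
    by (induction I rule: infinite_finite_induct) (simp_all add: Q_add Q0)
  have Q_mult_single: "Q (Poly_Mapping.single m c * u) = Poly_Mapping.single m c * Q u"
    if m: "m j = 0" for m c u
  proof (induction u rule: poly_mapping_additive_induct)
    case (single m' c')
    have "(m + m')(j := 0) = m + m'(j := 0)" using m by (auto simp: fun_eq_iff)
    then show ?case using m by (simp add: mult_single Q_single flip: mult.assoc)
  next
    case (add u v)
    then show ?case by (simp add: distrib_left Q_add)
  qed
  have Q_mult: "Q (t * u) = t * Q u" if t: "\<forall>m\<in>Poly_Mapping.keys t. m j = 0" for t u
  proof -
    have "Q (t * u) = Q (\<Sum>m\<in>Poly_Mapping.keys t. Poly_Mapping.single m (Poly_Mapping.lookup t m) * u)"
      by (simp flip: sum_distrib_right poly_mapping_sum_single)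
    also have "\<dots> = (\<Sum>m\<in>Poly_Mapping.keys t. Poly_Mapping.single m (Poly_Mapping.lookup t m) * Q u)"
      using t by (simp add: Q_sum Q_mult_single)
    also have "\<dots> = t * Q u"
      by (simp flip: sum_distrib_right poly_mapping_sum_single)
    finally show ?thesis .
  qed
  \<comment> \<open>On F[z_j, z_j^-1] the first factor of each term is a constant, so
    \<open>Q\<close> restricts to \<open>r\<close> by F-linearity.\<close>
  have Q_r: "Q v = r v" if v: "v \<in> laurent_sub j" for v
  proof -
    have "Q v = (\<Sum>m\<in>Poly_Mapping.keys v. r (Poly_Mapping.single m (Poly_Mapping.lookup v m)))"
      unfolding Q_def
    proof (rule sum.cong)
      fix m assume "m \<in> Poly_Mapping.keys v"
      then have "m = var_exp j (m j)" by (rule laurent_sub_var_exp[OF v])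
      moreover from this have "m(j := 0) = 0" by (auto simp: var_exp_def fun_eq_iff)
      ultimately show "Poly_Mapping.single (m(j := 0)) (Poly_Mapping.lookup v m)
          * r (Poly_Mapping.single (var_exp j (m j)) 1) = r (Poly_Mapping.single m (Poly_Mapping.lookup v m))"
        using r.scale[of "Poly_Mapping.lookup v m" "Poly_Mapping.single m 1"]
        by (simp add: single_eq_lconst_mult[of m "Poly_Mapping.lookup v m"] flip: lconst_def)
    qed simp
    then show ?thesis by (simp flip: r.sum poly_mapping_sum_single)
  qed
  have "Q (s * u) = u" for u
  proof (induction u rule: poly_mapping_additive_induct)
    case (single m c)
    have "m = m(j := 0) + var_exp j (m j)" by (auto simp: fun_eq_iff var_exp_def)
    then have m: "Poly_Mapping.single m c
        = Poly_Mapping.single (m(j := 0)) c * Poly_Mapping.single (var_exp j (m j)) 1"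
      by (simp add: mult_single)
    have "Q (s * Poly_Mapping.single m c)
        = Poly_Mapping.single (m(j := 0)) c * Q (s * Poly_Mapping.single (var_exp j (m j)) 1)"
      unfolding m by (subst Q_mult_single[symmetric]) (simp_all add: ac_simps)
    also have "\<dots> = Poly_Mapping.single m c"
      using Q_r[OF laurent_sub_mult[OF s(1) laurent_sub_single]] rs[rule_format, OF laurent_sub_single] m by simp
    finally show ?case .
  next
    case (add u v)
    then show ?case by (simp add: distrib_left Q_add)
  qed
  then show ?thesis using that Q_add Q_mult by blast
qed

section \<open>Linear maps on submodules\<close>

lemma submod_on_closed:
  assumes "submod_on R sc A"
  shows "0 \<in> A" "x \<in> A \<Longrightarrow> y \<in> A \<Longrightarrow> x + y \<in> A" "x \<in> A \<Longrightarrow> - x \<in> A"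
    "x \<in> A \<Longrightarrow> y \<in> A \<Longrightarrow> x - y \<in> A" "r \<in> R \<Longrightarrow> x \<in> A \<Longrightarrow> sc r x \<in> A"
  using assms unfolding submod_on_def by (auto simp: diff_conv_add_uminus simp del: add_uminus_conv_diff)

lemma submod_on_sum:
  "submod_on R sc A \<Longrightarrow> (\<And>i. i \<in> I \<Longrightarrow> f i \<in> A) \<Longrightarrow> sum f I \<in> A"
  by (induction I rule: infinite_finite_induct) (auto dest: submod_on_closed)

lemma lin_onD:
  assumes "lin_on R sa sb A B f"
  shows "x \<in> A \<Longrightarrow> f x \<in> B" "x \<in> A \<Longrightarrow> y \<in> A \<Longrightarrow> f (x + y) = f x + f y"
    "r \<in> R \<Longrightarrow> x \<in> A \<Longrightarrow> f (sa r x) = sb r (f x)"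
  using assms unfolding lin_on_def by auto

lemma lin_on_zero:
  assumes "lin_on R sa sb A B f" "0 \<in> A"
  shows "f 0 = 0"
  using lin_onD(2)[OF assms(1,2,2)] by simp

lemma lin_on_diff:
  assumes "lin_on R sa sb A B f" "submod_on R' sc A" "x \<in> A" "y \<in> A"
  shows "f (x - y) = f x - f y"
  using lin_onD(2)[OF assms(1), of "x - y" y] submod_on_closed(4)[OF assms(2)] assms(3,4)
  by (simp add: algebra_simps)

lemma lin_on_sum:
  assumes "lin_on R sa sb A B f" "submod_on R' sc A" "\<And>i. i \<in> I \<Longrightarrow> g i \<in> A"
  shows "f (sum g I) = (\<Sum>i\<in>I. f (g i))"
  using assms(3)
proof (induction I rule: infinite_finite_induct)
  case (insert x F)
  then show ?case
    by (simp add: lin_onD(2)[OF assms(1)] submod_on_sum[OF assms(2)])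
qed (simp_all add: lin_on_zero[OF assms(1)] submod_on_closed(1)[OF assms(2)])

lemma lin_on_lincomb:
  assumes f: "lin_on UNIV sa sb A B f" and A: "submod_on UNIV sa A" and g: "\<And>i. i \<in> I \<Longrightarrow> g i \<in> A"
  shows "f (\<Sum>i\<in>I. sa (c i) (g i)) = (\<Sum>i\<in>I. sb (c i) (f (g i)))"
proof -
  have "f (\<Sum>i\<in>I. sa (c i) (g i)) = (\<Sum>i\<in>I. f (sa (c i) (g i)))"
    by (rule lin_on_sum[OF f A]) (blast intro: submod_on_closed(5)[OF A] g)
  then show ?thesis by (simp add: lin_onD(3)[OF f] g)
qed

lemma submod_on_free_mod: "submod_on UNIV coord_scale (free_mod m :: (nat \<Rightarrow> 'r::comm_ring_1) set)"
  by (auto simp: submod_on_def free_mod_def coord_scale_def)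

section \<open>Tensoring with the rational functions\<close>

lemma laurent_to_ratfun_uminus: "laurent_to_ratfun j (- s) = - laurent_to_ratfun j s"
  using laurent_to_ratfun_add[of j s "- s"] by (simp add: eq_neg_iff_add_eq_0 add.commute)

lemma laurent_to_ratfun_of_int: "laurent_to_ratfun j (of_int n) = of_int n"
proof -
  have nat: "laurent_to_ratfun j (of_nat k) = of_nat k" for k
    by (induction k) (simp_all add: laurent_to_ratfun_add)
  show ?thesis
    by (cases n) (simp_all only: of_int_of_nat_eq of_int_minus laurent_to_ratfun_uminus nat)
qed

text \<open>Inverse of the embedding into F(z_j); its values are meaningful only on
  \<open>laurent_image j\<close>.\<close>

definition ratfun_to_laurent :: "'n \<Rightarrow> 'a::field ratfun \<Rightarrow> ('n, 'a) laurent" where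
  "ratfun_to_laurent j = inv_into (laurent_sub j) (laurent_to_ratfun j)"

abbreviation laurent_image :: "'n \<Rightarrow> 'a::field ratfun set" where
  "laurent_image j \<equiv> laurent_to_ratfun j ` laurent_sub j"

lemma ratfun_to_laurent_sub: "q \<in> laurent_image j \<Longrightarrow> ratfun_to_laurent j q \<in> laurent_sub j"
  by (simp add: ratfun_to_laurent_def inv_into_into)

lemma laurent_to_ratfun_inverse:
  "q \<in> laurent_image j \<Longrightarrow> laurent_to_ratfun j (ratfun_to_laurent j q) = q"
  by (simp add: ratfun_to_laurent_def f_inv_into_f)

lemma ratfun_to_laurent_inverse:
  "s \<in> laurent_sub j \<Longrightarrow> ratfun_to_laurent j (laurent_to_ratfun j s) = s"
  by (simp add: ratfun_to_laurent_def inv_into_f_f laurent_to_ratfun_inj_on)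

lemma ratfun_to_laurent_add:
  assumes "p \<in> laurent_image j" "q \<in> laurent_image j"
  shows "ratfun_to_laurent j (p + q) = ratfun_to_laurent j p + ratfun_to_laurent j q"
  using assms
  by (auto simp: ratfun_to_laurent_inverse laurent_sub_add simp flip: laurent_to_ratfun_add)

lemma laurent_image_mult:
  "p \<in> laurent_image j \<Longrightarrow> q \<in> laurent_image j \<Longrightarrow> p * q \<in> laurent_image j"
  by (auto simp: laurent_sub_mult simp flip: laurent_to_ratfun_mult)

lemma ratfun_to_laurent_mult:
  assumes "s \<in> laurent_sub j" "q \<in> laurent_image j"
  shows "ratfun_to_laurent j (laurent_to_ratfun j s * q) = s * ratfun_to_laurent j q"
  using assms
  by (auto simp: ratfun_to_laurent_inverse laurent_sub_mult simp flip: laurent_to_ratfun_mult)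

lemma common_denominator:
  assumes "finite K"
  obtains s where "s \<in> laurent_sub j" "s \<noteq> 0" "\<And>q. q \<in> K \<Longrightarrow> laurent_to_ratfun j s * q \<in> laurent_image j"
proof -
  have "\<exists>s\<in>laurent_sub j. s \<noteq> 0 \<and> (\<forall>q\<in>K. laurent_to_ratfun j s * q \<in> laurent_image j)"
    using assms
  proof (induction K)
    case empty
    show ?case using laurent_sub_1 zero_neq_one by (metis empty_iff)
  next
    case (insert q K)
    then obtain s where s: "s \<in> laurent_sub j" "s \<noteq> 0"
        "\<forall>q\<in>K. laurent_to_ratfun j s * q \<in> laurent_image j" by blast
    obtain t where t: "t \<in> laurent_sub j" "t \<noteq> 0" "laurent_to_ratfun j t * q \<in> laurent_image j"
      using ratfun_clear_denominator by metis
    have "laurent_to_ratfun j (t * s) * q' \<in> laurent_image j" if "q' \<in> insert q K" for q'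
    proof (cases "q' = q")
      case True
      have "laurent_to_ratfun j s * (laurent_to_ratfun j t * q) \<in> laurent_image j"
        using s t by (blast intro: laurent_image_mult)
      then show ?thesis using True by (simp add: laurent_to_ratfun_mult ac_simps)
    next
      case False
      then have "laurent_to_ratfun j t * (laurent_to_ratfun j s * q') \<in> laurent_image j"
        using s t that by (blast intro: laurent_image_mult)
      then show ?thesis by (simp add: laurent_to_ratfun_mult ac_simps)
    qed
    moreover have "t * s \<in> laurent_sub j" "t * s \<noteq> 0"
      using s t by (simp_all add: laurent_sub_mult laurent_sub_mult_nonzero)
    ultimately show ?case by blast
  qed
  then show ?thesis using that by blast
qed

text \<open>Stands for the multiplication by \<open>s\<close> from the part of the tensor product with denominator
  \<open>s\<close> to the module; it is junk unless \<open>s\<close> clears the denominators of all elementary tensors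
  of \<open>u\<close>.\<close>

definition tensor_clear ::
  "'n \<Rightarrow> (('n, 'a::field) laurent \<Rightarrow> 'm::ab_group_add \<Rightarrow> 'm) \<Rightarrow> ('n, 'a) laurent
     \<Rightarrow> ('m \<times> 'a ratfun \<Rightarrow>\<^sub>0 int) \<Rightarrow> 'm" where
  "tensor_clear j sc s u = (\<Sum>p\<in>Poly_Mapping.keys u.
     sc (of_int (Poly_Mapping.lookup u p) * ratfun_to_laurent j (laurent_to_ratfun j s * snd p)) (fst p))"

context
  fixes sc :: "('n, 'a::field) laurent \<Rightarrow> 'm::ab_group_add \<Rightarrow> 'm"
  assumes sc: "module sc"
begin

interpretation module sc by (rule sc)

lemma tensor_clear_add: "tensor_clear j sc s (u + v) = tensor_clear j sc s u + tensor_clear j sc s v"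
  unfolding tensor_clear_def
  by (rule setsum_keys_plus_distrib) (simp_all add: distrib_right scale_left_distrib)

lemma tensor_clear_single:
  "tensor_clear j sc s (Poly_Mapping.single (x, q) n)
     = sc (of_int n * ratfun_to_laurent j (laurent_to_ratfun j s * q)) x"
  by (cases "n = 0") (simp_all add: tensor_clear_def)

lemma tensor_clear_0 [simp]: "tensor_clear j sc s 0 = 0"
  by (simp add: tensor_clear_def)

lemma tensor_clear_uminus: "tensor_clear j sc s (- u) = - tensor_clear j sc s u"
  using tensor_clear_add[of j s u "- u"] by (simp add: eq_neg_iff_add_eq_0 add.commute)

lemma tensor_clear_diff: "tensor_clear j sc s (u - v) = tensor_clear j sc s u - tensor_clear j sc s v"
  using tensor_clear_add[of j s u "- v"] by (simp add: tensor_clear_uminus)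

lemma tensor_clear_sum: "tensor_clear j sc s (sum f I) = (\<Sum>i\<in>I. tensor_clear j sc s (f i))"
  by (induction I rule: infinite_finite_induct) (simp_all add: tensor_clear_add)

text \<open>For a fixed denominator the relations need not be respected, since junk values may
  enter; once the denominator clears the fractions involved, they are. Allowing every multiple
  \<open>t * s\<close> lets the claim pass to sums, where the product of two denominators serves
  both summands.\<close>

lemma tensor_clear_rel:
  assumes "u \<in> tensor_rel j sc A"
  obtains s where "s \<in> laurent_sub j" "s \<noteq> 0" "\<And>t. t \<in> laurent_sub j \<Longrightarrow> tensor_clear j sc (t * s) u = 0"
proof -
  have "\<exists>s\<in>laurent_sub j. s \<noteq> 0 \<and> (\<forall>t\<in>laurent_sub j. tensor_clear j sc (t * s) u = 0)"
    using assms
  proof induction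
    case rel_zero
    show ?case using laurent_sub_1 zero_neq_one by (metis tensor_clear_0)
  next
    case (rel_add u v)
    then obtain s s' where s: "s \<in> laurent_sub j" "s \<noteq> 0" "s' \<in> laurent_sub j" "s' \<noteq> 0"
      and u: "\<forall>t\<in>laurent_sub j. tensor_clear j sc (t * s) u = 0"
      and v: "\<forall>t\<in>laurent_sub j. tensor_clear j sc (t * s') v = 0" by blast
    have "tensor_clear j sc (t * (s * s')) (u + v) = 0" if t: "t \<in> laurent_sub j" for t
      using u[rule_format, OF laurent_sub_mult[OF t s(3)]] v[rule_format, OF laurent_sub_mult[OF t s(1)]]
      by (simp add: tensor_clear_add ac_simps)
    then show ?case
      using laurent_sub_mult[OF s(1,3)] laurent_sub_mult_nonzero[OF s(1,3,2,4)] by blast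
  next
    case (rel_neg u)
    then show ?case by (auto simp: tensor_clear_uminus)
  next
    \<comment> \<open>All three tensors share the second entry \<open>q\<close>, so they receive the
      same scalar, junk or not, and the denominator 1 will do.\<close>
    case (rel_left x y q)
    show ?case
      by (rule bexI[of _ 1])
        (simp_all add: laurent_sub_1 tensor_clear_diff tensor_clear_single scale_right_distrib)
  next
    case (rel_right x q q')
    obtain s where s: "s \<in> laurent_sub j" "s \<noteq> 0"
        "\<And>p. p \<in> {q, q'} \<Longrightarrow> laurent_to_ratfun j s * p \<in> laurent_image j"
      by (rule common_denominator[of "{q, q'}" j]) auto
    have "tensor_clear j sc (t * s) (Poly_Mapping.single (x, q + q') 1 - Poly_Mapping.single (x, q) 1
        - Poly_Mapping.single (x, q') 1) = 0" if t: "t \<in> laurent_sub j" for t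
    proof -
      have "laurent_to_ratfun j (t * s) * p \<in> laurent_image j" if "p \<in> {q, q'}" for p
        using laurent_image_mult[OF imageI[OF t] s(3)[OF that]]
        by (simp add: laurent_to_ratfun_mult mult.assoc)
      then show ?thesis
        by (simp add: tensor_clear_diff tensor_clear_single distrib_left ratfun_to_laurent_add
            scale_left_distrib)
    qed
    then show ?case using s by blast
  next
    case (rel_bal x r q)
    obtain s where s: "s \<in> laurent_sub j" "s \<noteq> 0" "laurent_to_ratfun j s * q \<in> laurent_image j"
      using ratfun_clear_denominator by metis
    have "tensor_clear j sc (t * s) (Poly_Mapping.single (sc r x, q) 1
        - Poly_Mapping.single (x, laurent_to_ratfun j r * q) 1) = 0" if t: "t \<in> laurent_sub j" for t
    proof -
      have "laurent_to_ratfun j (t * s) * q \<in> laurent_image j"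
        using laurent_image_mult[OF imageI[OF t] s(3)]
        by (simp add: laurent_to_ratfun_mult mult.assoc)
      from ratfun_to_laurent_mult[OF rel_bal(2) this] show ?thesis
        by (simp add: tensor_clear_diff tensor_clear_single ac_simps)
    qed
    then show ?case using s by blast
  qed
  then show ?thesis using that by blast
qed

lemma tensor_clear_closed:
  assumes "submod_on UNIV sc A" "u \<in> tensor_gens A"
  shows "tensor_clear j sc s u \<in> A"
  unfolding tensor_clear_def using assms
  by (intro submod_on_sum[OF assms(1)] submod_on_closed(5)[OF assms(1)]) (auto simp: tensor_gens_def)

lemma tensor_clear_map:
  assumes A: "submod_on UNIV sc A" and f: "lin_on UNIV sc sc A B f" and u: "u \<in> tensor_gens A"
  shows "tensor_clear j sc s (tensor_map f u) = f (tensor_clear j sc s u)"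
proof -
  have fst: "fst p \<in> A" if "p \<in> Poly_Mapping.keys u" for p
    using u that by (auto simp: tensor_gens_def)
  have "f (tensor_clear j sc s u) = (\<Sum>p\<in>Poly_Mapping.keys u. f (sc (of_int (Poly_Mapping.lookup u p)
      * ratfun_to_laurent j (laurent_to_ratfun j s * snd p)) (fst p)))"
    unfolding tensor_clear_def using fst
    by (intro lin_on_sum[OF f A] submod_on_closed(5)[OF A]) auto
  then show ?thesis
    by (simp add: tensor_map_def tensor_clear_sum tensor_clear_single lin_onD(3)[OF f] fst)
qed

section \<open>Calculation modulo the tensor relations\<close>

lemma tensor_rel_diff: "u \<in> tensor_rel j sc A \<Longrightarrow> v \<in> tensor_rel j sc A \<Longrightarrow> u - v \<in> tensor_rel j sc A"
  using tensor_rel.rel_add[OF _ tensor_rel.rel_neg] by fastforce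

lemma tensor_rel_trans:
  "u - v \<in> tensor_rel j sc A \<Longrightarrow> v - w \<in> tensor_rel j sc A \<Longrightarrow> u - w \<in> tensor_rel j sc A"
  using tensor_rel.rel_add by fastforce

lemma tensor_rel_sym: "u - v \<in> tensor_rel j sc A \<Longrightarrow> v - u \<in> tensor_rel j sc A"
  using tensor_rel.rel_neg by fastforce

lemma tensor_rel_zero_left: "0 \<in> A \<Longrightarrow> Poly_Mapping.single (0, q) 1 \<in> tensor_rel j sc A"
  using tensor_rel.rel_neg[OF tensor_rel.rel_left[of 0 A 0 q j sc]] by simp

lemma tensor_rel_zero_right: "x \<in> A \<Longrightarrow> Poly_Mapping.single (x, 0) 1 \<in> tensor_rel j sc A"
  using tensor_rel.rel_neg[OF tensor_rel.rel_right[of x A 0 0 j sc]] by simp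

text \<open>Moves the integer coefficients of the free abelian group into the second tensor factor,
  by induction from 0 in both directions.\<close>

lemma tensor_rel_of_int:
  assumes x: "x \<in> A"
  shows "Poly_Mapping.single (x, q) n - Poly_Mapping.single (x, of_int n * q) 1 \<in> tensor_rel j sc A"
proof (induction n rule: int_induct[of _ 0])
  case base
  show ?case using tensor_rel.rel_neg[OF tensor_rel_zero_right[OF x]] by simp
next
  case (step1 n)
  have "Poly_Mapping.single (x, q) (n + 1) - Poly_Mapping.single (x, of_int (n + 1) * q) 1
    = (Poly_Mapping.single (x, q) n - Poly_Mapping.single (x, of_int n * q) 1)
      - (Poly_Mapping.single (x, of_int n * q + q) 1 - Poly_Mapping.single (x, of_int n * q) 1
          - Poly_Mapping.single (x, q) 1)"
    by (simp add: single_add distrib_right)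
  then show ?case by (simp only: tensor_rel_diff[OF step1(2) tensor_rel.rel_right[OF x]])
next
  case (step2 n)
  have "Poly_Mapping.single (x, q) (n - 1) - Poly_Mapping.single (x, of_int (n - 1) * q) 1
    = (Poly_Mapping.single (x, q) n - Poly_Mapping.single (x, of_int n * q) 1)
      + (Poly_Mapping.single (x, of_int (n - 1) * q + q) 1 - Poly_Mapping.single (x, of_int (n - 1) * q) 1
          - Poly_Mapping.single (x, q) 1)"
    by (simp add: single_diff left_diff_distrib)
  then show ?case by (simp only: tensor_rel.rel_add[OF step2(2) tensor_rel.rel_right[OF x]])
qed

text \<open>Bringing all terms to the common denominator \<open>s\<close> turns an element of the
  tensor product into a single elementary tensor, the fraction with numerator
  \<open>tensor_clear j sc s u\<close>.\<close>

lemma tensor_gens_fraction: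
  assumes A: "submod_on UNIV sc A" and u: "u \<in> tensor_gens A"
    and s: "s \<in> laurent_sub j" "s \<noteq> 0"
    and clear: "\<And>p. p \<in> Poly_Mapping.keys u \<Longrightarrow> laurent_to_ratfun j s * snd p \<in> laurent_image j"
  shows "u - Poly_Mapping.single (tensor_clear j sc s u, inverse (laurent_to_ratfun j s)) 1
    \<in> tensor_rel j sc A"
proof -
  let ?i = "laurent_to_ratfun j" and ?R = "tensor_rel j sc A"
  define t where "t p = of_int (Poly_Mapping.lookup u p) * ratfun_to_laurent j (?i s * snd p)" for p
  have s0: "?i s \<noteq> 0" using s laurent_to_ratfun_eq_0_iff[OF s(1)] by simp
  have one: "Poly_Mapping.single p (Poly_Mapping.lookup u p)
      - Poly_Mapping.single (sc (t p) (fst p), inverse (?i s)) 1 \<in> ?R"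
    if p: "p \<in> Poly_Mapping.keys u" for p
  proof -
    have x: "fst p \<in> A" using u p by (auto simp: tensor_gens_def)
    have tp: "t p \<in> laurent_sub j"
      unfolding t_def using clear[OF p]
      by (intro laurent_sub_mult laurent_sub_of_int ratfun_to_laurent_sub)
    have "?i (t p) * inverse (?i s) = of_int (Poly_Mapping.lookup u p) * snd p"
      using s0 by (simp add: t_def laurent_to_ratfun_mult laurent_to_ratfun_of_int
          laurent_to_ratfun_inverse[OF clear[OF p]])
    with tensor_rel.rel_bal[OF x tp, of sc "inverse (?i s)"]
    have "Poly_Mapping.single (sc (t p) (fst p), inverse (?i s)) 1
        - Poly_Mapping.single (fst p, of_int (Poly_Mapping.lookup u p) * snd p) 1 \<in> ?R"
      by simp
    from tensor_rel_trans[OF tensor_rel_of_int[OF x] tensor_rel_sym[OF this]]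
    show ?thesis by simp
  qed
  have "(\<Sum>p\<in>K. Poly_Mapping.single p (Poly_Mapping.lookup u p))
      - Poly_Mapping.single (\<Sum>p\<in>K. sc (t p) (fst p), inverse (?i s)) 1 \<in> ?R"
    if "finite K" "K \<subseteq> Poly_Mapping.keys u" for K
    using that
  proof (induction K)
    case empty
    show ?case
      using tensor_rel.rel_neg[OF tensor_rel_zero_left[OF submod_on_closed(1)[OF A]]] by simp
  next
    case (insert p K)
    have cl: "sc (t p') (fst p') \<in> A" if "p' \<in> Poly_Mapping.keys u" for p'
      using u that by (intro submod_on_closed(5)[OF A]) (auto simp: tensor_gens_def)
    have IH: "(\<Sum>p\<in>K. Poly_Mapping.single p (Poly_Mapping.lookup u p))
        - Poly_Mapping.single (\<Sum>p\<in>K. sc (t p) (fst p), inverse (?i s)) 1 \<in> ?R"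
      and p: "p \<in> Poly_Mapping.keys u"
      using insert by simp_all
    have "sc (t p) (fst p) \<in> A" "(\<Sum>p\<in>K. sc (t p) (fst p)) \<in> A"
      using cl p insert.prems by (blast intro: submod_on_sum[OF A])+
    from tensor_rel_diff[OF tensor_rel.rel_add[OF one[OF p] IH]
        tensor_rel.rel_left[OF this, of "inverse (?i s)"]]
    show ?case using insert(1,2) by (simp add: algebra_simps)
  qed
  from this[OF finite_keys order_refl] show ?thesis
    by (simp add: tensor_clear_def t_def flip: poly_mapping_sum_single)
qed

end

text \<open>The homology modules are torsion over F[z_j, z_j^-1]. This is phrased with cycles and
  boundaries, which avoids quotients; the annihilator \<open>s\<close> may depend on the
  cycle.\<close>

definition torsion_homology ::
  "'n \<Rightarrow> (('n, 'a::field) laurent \<Rightarrow> 'm::ab_group_add \<Rightarrow> 'm) \<Rightarrow> (int \<Rightarrow> 'm set) \<Rightarrow> (int \<Rightarrow> 'm \<Rightarrow> 'm) \<Rightarrow> bool"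
  where
  "torsion_homology j sc C d \<longleftrightarrow> (\<forall>k. \<forall>x\<in>C k. d k x = 0 \<longrightarrow>
     (\<exists>s\<in>laurent_sub j. s \<noteq> 0 \<and> (\<exists>w\<in>C (k + 1). sc s x = d (k + 1) w)))"

text \<open>The last two facts are shifts by one degree with \<open>k + 1 - 1\<close> already
  simplified to \<open>k\<close>.\<close>

lemma chain_complexD:
  assumes "chain_complex sc C d"
  shows "module sc" "submod_on UNIV sc (C k)" "lin_on UNIV sc sc (C k) (C (k - 1)) (d k)"
    "x \<in> C k \<Longrightarrow> d (k - 1) (d k x) = 0"
    "lin_on UNIV sc sc (C (k + 1)) (C k) (d (k + 1))"
    "x \<in> C (k + 1) \<Longrightarrow> d k (d (k + 1) x) = 0"
proof -
  show *: "module sc" "submod_on UNIV sc (C k)" "lin_on UNIV sc sc (C k) (C (k - 1)) (d k)"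
    "x \<in> C k \<Longrightarrow> d (k - 1) (d k x) = 0" for k x
    using assms unfolding chain_complex_def by blast+
  show "lin_on UNIV sc sc (C (k + 1)) (C k) (d (k + 1))"
    "x \<in> C (k + 1) \<Longrightarrow> d k (d (k + 1) x) = 0"
    using *(3)[of "k + 1"] *(4)[of x "k + 1"] by simp_all
qed

lemma tensor_map_single: "tensor_map f (Poly_Mapping.single (x, q) n) = Poly_Mapping.single (f x, q) n"
  by (cases "n = 0") (simp_all add: tensor_map_def)

text \<open>This is exactness of localisation made explicit: cycles, boundaries and equations
  between fractions are moved to the module by clearing denominators.\<close>

lemma tensor_acyclic_iff_torsion_homology:
  fixes sc :: "('n, 'a::field) laurent \<Rightarrow> 'm::ab_group_add \<Rightarrow> 'm"
  assumes CC: "chain_complex sc C d"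
  shows "tensor_acyclic j sc C d \<longleftrightarrow> torsion_homology j sc C d"
proof
  note cc = chain_complexD[OF CC]
  assume ac: "tensor_acyclic j sc C d"
  show "torsion_homology j sc C d"
    unfolding torsion_homology_def
  proof (intro allI ballI impI)
    fix k x assume x: "x \<in> C k" "d k x = 0"
    \<comment> \<open>A cycle \<open>x\<close> enters the tensor product as the tensor of
      \<open>x\<close> with 1.\<close>
    let ?u = "Poly_Mapping.single (x, 1) 1 :: 'm \<times> 'a ratfun \<Rightarrow>\<^sub>0 int"
    have "?u \<in> tensor_gens (C k)" using x by (simp add: tensor_gens_def)
    moreover have "tensor_map (d k) ?u \<in> tensor_rel j sc (C (k - 1))"
      using x tensor_rel_zero_left[OF cc(1) submod_on_closed(1)[OF cc(2)]]
      by (simp add: tensor_map_single)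
    ultimately obtain w where w: "w \<in> tensor_gens (C (k + 1))"
        "?u - tensor_map (d (k + 1)) w \<in> tensor_rel j sc (C k)"
      using ac unfolding tensor_acyclic_def by blast
    obtain s where s: "s \<in> laurent_sub j" "s \<noteq> 0" and
        cl: "\<And>t. t \<in> laurent_sub j \<Longrightarrow> tensor_clear j sc (t * s) (?u - tensor_map (d (k + 1)) w) = 0"
      by (rule tensor_clear_rel[OF cc(1) w(2)]) blast
    have "tensor_clear j sc s (?u - tensor_map (d (k + 1)) w) = 0"
      using cl[OF laurent_sub_1] by simp
    then have "sc s x = d (k + 1) (tensor_clear j sc s w)"
      using s(1) by (simp add: tensor_clear_diff[OF cc(1)] tensor_clear_single[OF cc(1)]
          tensor_clear_map[OF cc(1,2) cc(5) w(1)] ratfun_to_laurent_inverse)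
    moreover have "tensor_clear j sc s w \<in> C (k + 1)" by (rule tensor_clear_closed[OF cc(1,2) w(1)])
    ultimately show "\<exists>s\<in>laurent_sub j. s \<noteq> 0 \<and> (\<exists>w\<in>C (k + 1). sc s x = d (k + 1) w)"
      using s by blast
  qed
next
  note cc = chain_complexD[OF CC]
  interpret module sc by (rule cc(1))
  let ?i = "laurent_to_ratfun j"
  assume tor: "torsion_homology j sc C d"
  show "tensor_acyclic j sc C d"
    unfolding tensor_acyclic_def
  proof (intro allI ballI impI)
    fix k u assume u: "u \<in> tensor_gens (C k)" "tensor_map (d k) u \<in> tensor_rel j sc (C (k - 1))"
    obtain s0 where s0: "s0 \<in> laurent_sub j" "s0 \<noteq> 0" and
        cl: "\<And>t. t \<in> laurent_sub j \<Longrightarrow> tensor_clear j sc (t * s0) (tensor_map (d k) u) = 0"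
      by (rule tensor_clear_rel[OF cc(1) u(2)]) blast
    obtain t where t: "t \<in> laurent_sub j" "t \<noteq> 0"
        "\<And>q. q \<in> snd ` Poly_Mapping.keys u \<Longrightarrow> ?i t * q \<in> laurent_image j"
      by (rule common_denominator[of "snd ` Poly_Mapping.keys u" j]) auto
    \<comment> \<open>The factor \<open>t\<close> clears the denominators of \<open>u\<close>, and
      \<open>s0\<close> turns the vanishing of the boundary modulo relations into vanishing in the
      module; the product does both.\<close>
    define s where "s = t * s0"
    have s: "s \<in> laurent_sub j" "s \<noteq> 0"
      using s0 t by (simp_all add: s_def laurent_sub_mult laurent_sub_mult_nonzero)
    define x where "x = tensor_clear j sc s u"
    have x: "x \<in> C k" unfolding x_def by (rule tensor_clear_closed[OF cc(1,2) u(1)])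
    have "d k x = 0"
      using cl[OF t(1)] tensor_clear_map[OF cc(1,2,3) u(1)] by (simp add: x_def s_def)
    then obtain r w where r: "r \<in> laurent_sub j" "r \<noteq> 0" and w: "w \<in> C (k + 1)" "sc r x = d (k + 1) w"
      using tor x unfolding torsion_homology_def by blast
    have "?i s * snd p \<in> laurent_image j" if "p \<in> Poly_Mapping.keys u" for p
      using laurent_image_mult[OF imageI[OF s0(1)] t(3)[OF imageI[OF that]]]
      by (simp add: s_def laurent_to_ratfun_mult ac_simps)
    from tensor_gens_fraction[OF cc(1,2) u(1) s this]
    have 1: "u - Poly_Mapping.single (x, inverse (?i s)) 1 \<in> tensor_rel j sc (C k)"
      by (simp add: x_def)
    have "?i r \<noteq> 0" using r laurent_to_ratfun_eq_0_iff[OF r(1)] by simp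
    \<comment> \<open>The fraction x/s is expanded to (r x)/(r s), whose numerator is the boundary
      of \<open>w\<close>; so w/(r s) is the required preimage.\<close>
    then have "Poly_Mapping.single (sc r x, inverse (?i r) * inverse (?i s)) 1
        - Poly_Mapping.single (x, inverse (?i s)) 1 \<in> tensor_rel j sc (C k)"
      using tensor_rel.rel_bal[OF x r(1), of sc "inverse (?i r) * inverse (?i s)"]
      by (simp flip: mult.assoc)
    from tensor_rel_trans[OF cc(1) 1 tensor_rel_sym[OF cc(1) this]]
    have "u - tensor_map (d (k + 1)) (Poly_Mapping.single (w, inverse (?i r) * inverse (?i s)) 1)
        \<in> tensor_rel j sc (C k)"
      by (simp add: w tensor_map_single)
    moreover have "Poly_Mapping.single (w, inverse (?i r) * inverse (?i s)) 1 \<in> tensor_gens (C (k + 1))"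
      using w by (simp add: tensor_gens_def)
    ultimately show "\<exists>w\<in>tensor_gens (C (k + 1)). u - tensor_map (d (k + 1)) w \<in> tensor_rel j sc (C k)"
      by blast
  qed
qed

section \<open>Finite domination makes the homology torsion\<close>

lemma vector_space_coord_scale: "vector_space (coord_scale :: 'a::field \<Rightarrow> _)"
  by unfold_locales (auto simp: coord_scale_def fun_eq_iff algebra_simps)

lemma free_mod_sum_unit:
  fixes v :: "nat \<Rightarrow> 'r::comm_ring_1"
  assumes "v \<in> free_mod m"
  shows "v = (\<Sum>l<m. coord_scale (v l) (\<lambda>i. if i = l then 1 else 0))"
proof
  fix i
  have sum_apply: "(\<Sum>l\<in>A. g l) i = (\<Sum>l\<in>A. g l i)" for A i and g :: "nat \<Rightarrow> nat \<Rightarrow> 'r"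
    by (induction A rule: infinite_finite_induct) auto
  have "(\<Sum>l<m. v l * (if i = l then 1 else 0)) = (\<Sum>l<m. if l = i then v l else 0)"
    by (rule sum.cong) auto
  then show "v i = (\<Sum>l<m. coord_scale (v l) (\<lambda>i. if i = l then 1 else 0)) i"
    using assms by (simp add: sum_apply coord_scale_def free_mod_def)
qed

text \<open>This states dependence for a family of n + 1 vectors in F^n, with repetitions
  allowed.\<close>

lemma free_mod_dependent:
  fixes v :: "nat \<Rightarrow> nat \<Rightarrow> 'a::field"
  assumes v: "\<And>i. i \<le> n \<Longrightarrow> v i \<in> free_mod n"
  obtains c where "\<exists>i\<le>n. c i \<noteq> 0" "(\<Sum>i\<le>n. coord_scale (c i) (v i)) = 0"
proof (cases "inj_on v {..n}")
  \<comment> \<open>Linear dependence in the vector space locale concerns sets, so a repeated vector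
    is treated apart, with the coefficients 1 and -1.\<close>
  case False
  then obtain i i' where i: "i \<le> n" "i' \<le> n" "i \<noteq> i'" "v i = v i'"
    by (auto simp: inj_on_def)
  interpret vector_space "coord_scale :: 'a \<Rightarrow> _" by (rule vector_space_coord_scale)
  define c :: "nat \<Rightarrow> 'a" where "c l = (if l = i then 1 else if l = i' then - 1 else 0)" for l
  have "(\<Sum>l\<le>n. coord_scale (c l) (v l)) = (\<Sum>l\<in>{i, i'}. coord_scale (c l) (v l))"
    using i by (intro sum.mono_neutral_right) (auto simp: c_def)
  also have "\<dots> = 0" using i by (simp add: c_def)
  finally have "(\<Sum>l\<le>n. coord_scale (c l) (v l)) = 0" .
  moreover have "c i \<noteq> 0" by (simp add: c_def)
  ultimately show ?thesis using that i by blast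
next
  case True
  interpret vector_space "coord_scale :: 'a \<Rightarrow> _" by (rule vector_space_coord_scale)
  define e :: "nat \<Rightarrow> nat \<Rightarrow> 'a" where "e l = (\<lambda>i. if i = l then 1 else 0)" for l
  have "x \<in> span (e ` {..<n})" if "x \<in> free_mod n" for x
  proof -
    have "x = (\<Sum>l<n. coord_scale (x l) (e l))"
      unfolding e_def by (rule free_mod_sum_unit[OF that])
    moreover have "(\<Sum>l<n. coord_scale (x l) (e l)) \<in> span (e ` {..<n})"
      by (intro span_sum span_scale span_base) auto
    ultimately show ?thesis by simp
  qed
  then have sub: "v ` {..n} \<subseteq> span (e ` {..<n})" using v by auto
  have "dependent (v ` {..n})"
  proof (rule ccontr)
    assume "independent (v ` {..n})"
    from independent_span_bound[OF _ this sub] have "card (v ` {..n}) \<le> card (e ` {..<n})" by simp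
    also have "\<dots> \<le> n" using card_image_le[of "{..<n}" e] by simp
    finally show False using True by (simp add: card_image)
  qed
  then obtain u x where u: "x \<in> v ` {..n}" "u x \<noteq> 0" "(\<Sum>y\<in>v ` {..n}. coord_scale (u y) y) = 0"
    by (auto simp: dependent_finite)
  then have "(\<Sum>i\<le>n. coord_scale (u (v i)) (v i)) = 0" using True by (simp add: sum.reindex)
  then show ?thesis using that[of "u \<circ> v"] u by auto
qed

lemma finitely_dominated_imp_torsion_homology:
  fixes sc :: "('n, 'a::field) laurent \<Rightarrow> 'm::ab_group_add \<Rightarrow> 'm"
  assumes CC: "chain_complex sc C d" and fd: "F_finitely_dominated sc C d"
  shows "torsion_homology j sc C d"
  unfolding torsion_homology_def
proof (intro allI ballI impI)
  note cc = chain_complexD[OF CC]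
  interpret module sc by (rule cc(1))
  fix k x assume x: "x \<in> C k" "d k x = 0"
  obtain dim :: "int \<Rightarrow> nat" and f g h where
    f': "\<forall>k. lin_on UNIV (\<lambda>c. sc (lconst c)) coord_scale (C k) (free_mod (dim k)) (f k)" and
    g': "\<forall>k. lin_on UNIV coord_scale (\<lambda>c. sc (lconst c)) (free_mod (dim k)) (C k) (g k)" and
    h': "\<forall>k. lin_on UNIV (\<lambda>c. sc (lconst c)) (\<lambda>c. sc (lconst c)) (C k) (C (k + 1)) (h k)" and
    gf': "\<forall>k. \<forall>x\<in>C k. x - g k (f k x) = d (k + 1) (h k x) + h (k - 1) (d k x)"
    using fd unfolding F_finitely_dominated_def Let_def
    by (elim exE conjE) (rule that, assumption+)
  note f = f'[rule_format] and g = g'[rule_format] and h = h'[rule_format] and gf = gf'[rule_format]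
  \<comment> \<open>The \<open>dim k + 1\<close> elements z_j^i x have linearly dependent images in
    F^(dim k); the coefficients of a dependence give the annihilator \<open>s\<close>.\<close>
  define z where "z i = sc (Poly_Mapping.single (var_exp j (int i)) 1) x" for i
  have z: "z i \<in> C k" for i
    unfolding z_def using submod_on_closed(5)[OF cc(2)] x by blast
  obtain c where c: "\<exists>i\<le>dim k. c i \<noteq> 0" "(\<Sum>i\<le>dim k. coord_scale (c i) (f k (z i))) = 0"
    by (rule free_mod_dependent[of "dim k" "\<lambda>i. f k (z i)"]) (use lin_onD(1)[OF f] z in blast)+
  define s where "s = (\<Sum>i\<le>dim k. Poly_Mapping.single (var_exp j (int i)) (c i))"
  have "s \<in> laurent_sub j" unfolding s_def by (intro laurent_sub_sum laurent_sub_single)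
  moreover have "s \<noteq> 0"
  proof -
    from c obtain i where i: "i \<le> dim k" "c i \<noteq> 0" by blast
    have "Poly_Mapping.lookup s (var_exp j (int i)) = (\<Sum>l\<le>dim k. if l = i then c l else 0)"
      unfolding s_def lookup_sum by (rule sum.cong) (auto simp: lookup_single when_def)
    then have "Poly_Mapping.lookup s (var_exp j (int i)) \<noteq> 0" using i by simp
    then show ?thesis by auto
  qed
  \<comment> \<open>Since \<open>f k\<close> kills the cycle \<open>sc s x\<close>, the homotopy
    identity leaves only the boundary of \<open>h k (sc s x)\<close>.\<close>
  moreover have "sc s x = d (k + 1) (h k (sc s x))"
  proof -
    have sx: "sc s x \<in> C k" using submod_on_closed(5)[OF cc(2)] x by blast
    have sx_sum: "sc s x = (\<Sum>i\<le>dim k. sc (lconst (c i)) (z i))"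
      unfolding s_def scale_sum_left z_def scale_scale single_eq_lconst_mult[symmetric] by simp
    have "submod_on UNIV (\<lambda>c. sc (lconst c)) (C k)"
      using cc(2)[of k] unfolding submod_on_def by blast
    then have "f k (sc s x) = (\<Sum>i\<le>dim k. coord_scale (c i) (f k (z i)))"
      unfolding sx_sum using z by (intro lin_on_lincomb[OF f])
    also have "\<dots> = 0" by (rule c(2))
    finally have "f k (sc s x) = 0" .
    moreover have "g k 0 = 0" by (rule lin_on_zero[OF g]) (simp add: free_mod_def)
    moreover have "d k (sc s x) = 0" using lin_onD(3)[OF cc(3)] x by simp
    moreover have "h (k - 1) 0 = 0" by (rule lin_on_zero[OF h submod_on_closed(1)[OF cc(2)]])
    ultimately show ?thesis using gf[OF sx] by simp
  qed
  moreover have "h k (sc s x) \<in> C (k + 1)"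
    using lin_onD(1)[OF h] submod_on_closed(5)[OF cc(2)] x by blast
  ultimately show "\<exists>s\<in>laurent_sub j. s \<noteq> 0 \<and> (\<exists>w\<in>C (k + 1). sc s x = d (k + 1) w)" by blast
qed

section \<open>Null-homotopies from torsion homology\<close>

text \<open>The coordinate functions \<open>a l\<close> and the images \<open>b l\<close> of the
  unit vectors form a dual basis, through which maps out of a projective module can be prescribed on
  finitely many elements.\<close>

lemma fg_projective_dual_basis:
  fixes sc :: "'r::comm_ring_1 \<Rightarrow> 'm::ab_group_add \<Rightarrow> 'm"
  assumes "fg_projective sc A"
  obtains m :: nat and a b where "\<And>l. l < m \<Longrightarrow> b l \<in> A"
    "\<And>l x y. x \<in> A \<Longrightarrow> y \<in> A \<Longrightarrow> a l (x + y) = a l x + a l y"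
    "\<And>l r x. x \<in> A \<Longrightarrow> a l (sc r x) = r * a l x"
    "\<And>x. x \<in> A \<Longrightarrow> x = (\<Sum>l<m. sc (a l x) (b l))"
proof -
  obtain m i p where i: "lin_on UNIV sc coord_scale A (free_mod m) i"
    and p: "lin_on UNIV coord_scale sc (free_mod m) A p" and pi: "\<And>x. x \<in> A \<Longrightarrow> p (i x) = x"
    using assms unfolding fg_projective_def by blast
  let ?e = "\<lambda>l i. if i = l then 1 else 0 :: 'r"
  have e: "?e l \<in> free_mod m" if "l < m" for l using that by (simp add: free_mod_def)
  show ?thesis
  proof (rule that)
    show "p (?e l) \<in> A" if "l < m" for l using lin_onD(1)[OF p e[OF that]] .
    show "i (x + y) l = i x l + i y l" if "x \<in> A" "y \<in> A" for l x y
      using lin_onD(2)[OF i that] by simp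
    show "i (sc r x) l = r * i x l" if "x \<in> A" for l r x
      using lin_onD(3)[OF i _ that] by (simp add: coord_scale_def)
    fix x assume x: "x \<in> A"
    have "x = p (i x)" using pi x by simp
    also have "\<dots> = p (\<Sum>l<m. coord_scale (i x l) (?e l))"
      using free_mod_sum_unit[OF lin_onD(1)[OF i x]] by simp
    also have "\<dots> = (\<Sum>l<m. sc (i x l) (p (?e l)))"
      using e by (intro lin_on_lincomb[OF p submod_on_free_mod]) simp
    finally show "x = (\<Sum>l<m. sc (i x l) (p (?e l)))" .
  qed
qed

text \<open>The product of the individual annihilators works for all of the finitely many
  cycles.\<close>

lemma torsion_homology_finite:
  fixes sc :: "('n, 'a::field) laurent \<Rightarrow> 'm::ab_group_add \<Rightarrow> 'm"
  assumes CC: "chain_complex sc C d" and tor: "torsion_homology j sc C d"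
    and "finite Y" "Y \<subseteq> {y \<in> C k. d k y = 0}"
  shows "\<exists>s\<in>laurent_sub j. s \<noteq> 0 \<and> (\<forall>y\<in>Y. \<exists>w\<in>C (k + 1). sc s y = d (k + 1) w)"
  using assms(3,4)
proof (induction Y)
  case empty
  show ?case using laurent_sub_1 zero_neq_one by (metis empty_iff)
next
  case (insert y Y)
  note cc = chain_complexD[OF CC]
  interpret module sc by (rule cc(1))
  from insert obtain s where s: "s \<in> laurent_sub j" "s \<noteq> 0"
      "\<forall>y\<in>Y. \<exists>w\<in>C (k + 1). sc s y = d (k + 1) w" by blast
  from insert.prems tor obtain t w where t: "t \<in> laurent_sub j" "t \<noteq> 0" "w \<in> C (k + 1)" "sc t y = d (k + 1) w"
    unfolding torsion_homology_def by blast
  have "\<exists>w\<in>C (k + 1). sc (s * t) y' = d (k + 1) w" if y': "y' \<in> insert y Y" for y'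
  proof (cases "y' = y")
    case True
    have "sc (s * t) y = d (k + 1) (sc s w)"
      using t by (simp add: lin_onD(3)[OF cc(3)] flip: scale_scale)
    then show ?thesis using True submod_on_closed(5)[OF cc(2)] t by blast
  next
    case False
    then obtain w' where w': "w' \<in> C (k + 1)" "sc s y' = d (k + 1) w'"
      using s(3) y' by auto
    have "sc (s * t) y' = sc t (sc s y')" by (simp add: mult.commute)
    then have "sc (s * t) y' = d (k + 1) (sc t w')"
      using w' by (simp add: lin_onD(3)[OF cc(3)])
    then show ?thesis using submod_on_closed(5)[OF cc(2)] w' by blast
  qed
  then show ?case
    using laurent_sub_mult[OF s(1) t(1)] laurent_sub_mult_nonzero[OF s(1) t(1) s(2) t(2)] by blast
qed

definition null_homotopic_by ::
  "('r::comm_ring_1 \<Rightarrow> 'm::ab_group_add \<Rightarrow> 'm) \<Rightarrow> (int \<Rightarrow> 'm set) \<Rightarrow> (int \<Rightarrow> 'm \<Rightarrow> 'm)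
     \<Rightarrow> 'r \<Rightarrow> (int \<Rightarrow> 'm \<Rightarrow> 'm) \<Rightarrow> bool" where
  "null_homotopic_by sc C d p h \<longleftrightarrow> (\<forall>k. lin_on UNIV sc sc (C k) (C (k + 1)) (h k)) \<and>
     (\<forall>k. \<forall>x\<in>C k. sc p x = d (k + 1) (h k x) + h (k - 1) (d k x))"

lemma torsion_homology_imp_null_homotopic:
  fixes sc :: "('n, 'a::field) laurent \<Rightarrow> 'm::ab_group_add \<Rightarrow> 'm"
  assumes CC: "chain_complex sc C d" and bd: "bounded_complex C"
    and proj: "\<And>k. fg_projective sc (C k)" and tor: "torsion_homology j sc C d"
  obtains p h where "p \<in> laurent_sub j" "p \<noteq> 0" "null_homotopic_by sc C d p h"
proof -
  note cc = chain_complexD[OF CC]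
  interpret module sc by (rule cc(1))
  note closed = submod_on_closed[OF cc(2)]
  obtain N where N: "\<And>k. \<bar>k\<bar> > N \<Longrightarrow> C k = {0}" using bd unfolding bounded_complex_def by blast
  have d0: "d k 0 = 0" for k by (rule lin_on_zero[OF cc(3) closed(1)])
  \<comment> \<open>Induction upwards through the degrees: at stage \<open>K\<close> the homotopy
    identity holds in all degrees below \<open>K - N\<close>. It starts where the modules are zero,
    and \<open>p\<close> gains a factor at each stage.\<close>
  have "\<exists>p h. p \<in> laurent_sub j \<and> p \<noteq> 0 \<and> (\<forall>k. lin_on UNIV sc sc (C k) (C (k + 1)) (h k)) \<and>
     (\<forall>k\<le>int K - N - 1. \<forall>x\<in>C k. sc p x = d (k + 1) (h k x) + h (k - 1) (d k x))" for K
  proof (induction K)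
    case 0
    have "sc 1 x = d (k + 1) 0 + 0" if "k \<le> int 0 - N - 1" "x \<in> C k" for k x
      using N[of k] that by (simp add: d0)
    then show ?case
      using laurent_sub_1 closed(1)
      by (intro exI[of _ 1] exI[of _ "\<lambda>_ _. 0"]) (auto simp: lin_on_def)
  next
    case (Suc K)
    then obtain p h where p: "p \<in> laurent_sub j" "p \<noteq> 0"
      and h: "\<And>k. lin_on UNIV sc sc (C k) (C (k + 1)) (h k)"
      and ph: "\<And>k x. k \<le> int K - N - 1 \<Longrightarrow> x \<in> C k \<Longrightarrow> sc p x = d (k + 1) (h k x) + h (k - 1) (d k x)"
      by blast
    define k where "k = int K - N"
    obtain m :: nat and a b where b: "\<And>l. l < m \<Longrightarrow> b l \<in> C k"
      and a_add: "\<And>l x y. x \<in> C k \<Longrightarrow> y \<in> C k \<Longrightarrow> a l (x + y) = a l x + a l y"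
      and a_sc: "\<And>l r x. x \<in> C k \<Longrightarrow> a l (sc r x) = r * a l x"
      and ab: "\<And>x. x \<in> C k \<Longrightarrow> x = (\<Sum>l<m. sc (a l x) (b l))"
      by (rule fg_projective_dual_basis[OF proj[of k]]) blast
    \<comment> \<open>The defect of the homotopy identity in the first untreated degree
      \<open>k\<close>. By the identity in degree \<open>k - 1\<close> its values are
      cycles.\<close>
    define y where "y x = sc p x - h (k - 1) (d k x)" for x
    have hk: "lin_on UNIV sc sc (C (k - 1)) (C k) (h (k - 1))" using h[of "k - 1"] by simp
    have dk: "x \<in> C k \<Longrightarrow> d k x \<in> C (k - 1)" for x by (rule lin_onD(1)[OF cc(3)])
    have y: "lin_on UNIV sc sc (C k) (C k) y"
      unfolding lin_on_def y_def
      using lin_onD(1)[OF hk] dk closed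
      by (auto simp: lin_onD[OF cc(3)] lin_onD[OF hk] scale_right_distrib scale_right_diff_distrib
          mult.commute)
    have cyc: "d k (y x) = 0" if x: "x \<in> C k" for x
    proof -
      have "d k (y x) = sc p (d k x) - d k (h (k - 1) (d k x))"
        unfolding y_def using x closed lin_onD(1)[OF hk] dk
        by (simp add: lin_on_diff[OF cc(3) cc(2)] lin_onD(3)[OF cc(3)])
      also have "sc p (d k x) = d k (h (k - 1) (d k x)) + h (k - 2) (d (k - 1) (d k x))"
        using ph[OF _ dk[OF x]] by (simp add: k_def)
      also have "h (k - 2) (d (k - 1) (d k x)) = 0"
        using cc(4)[OF x] lin_on_zero[OF h closed(1)] by simp
      finally show ?thesis by simp
    qed
    have "(\<lambda>l. y (b l)) ` {..<m} \<subseteq> {y \<in> C k. d k y = 0}"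
      using cyc b lin_onD(1)[OF y] by auto
    from torsion_homology_finite[OF CC tor _ this] obtain s where s: "s \<in> laurent_sub j" "s \<noteq> 0"
      and "\<forall>y\<in>(\<lambda>l. y (b l)) ` {..<m}. \<exists>w\<in>C (k + 1). sc s y = d (k + 1) w" by blast
    then have "\<forall>l. \<exists>w. l < m \<longrightarrow> w \<in> C (k + 1) \<and> sc s (y (b l)) = d (k + 1) w" by fastforce
    then obtain w where w: "\<And>l. l < m \<Longrightarrow> w l \<in> C (k + 1)"
        "\<And>l. l < m \<Longrightarrow> sc s (y (b l)) = d (k + 1) (w l)" by metis
    \<comment> \<open>In degree \<open>k\<close> the new map sends the generator \<open>b l\<close>
      to the chain bounding \<open>sc s (y (b l))\<close>, extended through the dual basis; in the
      other degrees \<open>h\<close> is rescaled so that the identity holds for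
      \<open>s * p\<close>.\<close>
    define h' where "h' k' x = (if k' = k then \<Sum>l<m. sc (a l x) (w l) else sc s (h k' x))" for k' x
    have wl: "sc r (w l) \<in> C (k + 1)" if "l < m" for r l
      using closed(5) w(1)[OF that] by simp
    have lin: "lin_on UNIV sc sc (C k') (C (k' + 1)) (h' k')" for k'
    proof (cases "k' = k")
      case True
      then show ?thesis
        using wl unfolding lin_on_def h'_def
        by (auto intro!: submod_on_sum[OF cc(2)]
            simp: a_add a_sc scale_left_distrib sum.distrib scale_sum_right)
    next
      case False
      then show ?thesis
        using closed lin_onD[OF h] unfolding lin_on_def h'_def
        by (auto simp: scale_right_distrib mult.commute)
    qed
    have new: "sc (s * p) x = d (k + 1) (h' k x) + h' (k - 1) (d k x)" if x: "x \<in> C k" for x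
    proof -
      have "d (k + 1) (h' k x) = (\<Sum>l<m. sc (a l x) (d (k + 1) (w l)))"
        unfolding h'_def using w(1) by (simp only: simp_thms if_True) (rule lin_on_lincomb[OF cc(5,2)], simp)
      also have "\<dots> = (\<Sum>l<m. sc s (sc (a l x) (y (b l))))"
        using w(2) by (intro sum.cong refl) (simp add: mult.commute[of s] flip: w(2))
      also have "\<dots> = sc s (y (\<Sum>l<m. sc (a l x) (b l)))"
      proof -
        have "y (\<Sum>l<m. sc (a l x) (b l)) = (\<Sum>l<m. sc (a l x) (y (b l)))"
          using b by (intro lin_on_lincomb[OF y cc(2)]) simp
        then show ?thesis by (simp add: scale_sum_right)
      qed
      also have "\<dots> = sc s (y x)" using ab[OF x] by simp
      finally show ?thesis by (simp add: h'_def y_def scale_right_diff_distrib)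
    qed
    have old: "sc (s * p) x = d (k' + 1) (h' k' x) + h' (k' - 1) (d k' x)" if "k' < k" "x \<in> C k'" for k' x
    proof -
      have "sc (s * p) x = sc s (d (k' + 1) (h k' x) + h (k' - 1) (d k' x))"
        using ph[of k' x] that by (simp add: k_def flip: scale_scale)
      then show ?thesis
        using that lin_onD(1)[OF h that(2)]
        by (simp add: h'_def scale_right_distrib lin_onD(3)[OF cc(3)])
    qed
    have "sc (s * p) x = d (k' + 1) (h' k' x) + h' (k' - 1) (d k' x)"
      if "k' \<le> int (Suc K) - N - 1" "x \<in> C k'" for k' x
      using that new old[of k' x] by (cases "k' = k") (auto simp: k_def)
    then show ?case
      using lin laurent_sub_mult[OF s(1) p(1)] laurent_sub_mult_nonzero[OF s(1) p(1) s(2) p(2)] by blast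
  qed
  \<comment> \<open>With this many stages the identity reaches degree \<open>N\<close>; above
    \<open>N\<close> the modules vanish.\<close>
  from this[of "nat (2 * N + 1)"] obtain p h where p: "p \<in> laurent_sub j" "p \<noteq> 0"
    and h: "\<And>k. lin_on UNIV sc sc (C k) (C (k + 1)) (h k)"
    and ph: "\<And>k x. k \<le> N \<Longrightarrow> x \<in> C k \<Longrightarrow> sc p x = d (k + 1) (h k x) + h (k - 1) (d k x)"
    by force
  have h0: "h k 0 = 0" for k by (rule lin_on_zero[OF h closed(1)])
  have "sc p x = d (k + 1) (h k x) + h (k - 1) (d k x)" if x: "x \<in> C k" for k x
    using ph[OF _ x] N[of k] x by (cases "k \<le> N") (auto simp: d0 h0)
  with h have "null_homotopic_by sc C d p h" by (simp add: null_homotopic_by_def)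
  with p show ?thesis by (rule that)
qed

section \<open>Composing homotopies over the variables\<close>

text \<open>The self-map of the complex that \<open>H\<close> makes homotopic to the
  identity.\<close>

definition homotopy_map ::
  "(int \<Rightarrow> 'm::ab_group_add \<Rightarrow> 'm) \<Rightarrow> (int \<Rightarrow> 'm \<Rightarrow> 'm) \<Rightarrow> int \<Rightarrow> 'm \<Rightarrow> 'm" where
  "homotopy_map d H k x = x - d (k + 1) (H k x) - H (k - 1) (d k x)"

text \<open>The Laurent polynomials in the variables outside \<open>J\<close>. Homotopies built from
  divisions in the variables of \<open>J\<close> stay linear over this ring; for
  \<open>J = UNIV\<close> only the constants remain.\<close>

definition laurent_free_of :: "'n set \<Rightarrow> ('n, 'a::zero) laurent set" where
  "laurent_free_of J = {t. \<forall>m\<in>Poly_Mapping.keys t. \<forall>j\<in>J. m j = 0}"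

lemma lin_on_mono: "lin_on R sa sb A B f \<Longrightarrow> R' \<subseteq> R \<Longrightarrow> lin_on R' sa sb A B f"
  unfolding lin_on_def by blast

context
  fixes sc :: "('n, 'a::field) laurent \<Rightarrow> 'm::ab_group_add \<Rightarrow> 'm"
    and C :: "int \<Rightarrow> 'm set" and d :: "int \<Rightarrow> 'm \<Rightarrow> 'm"
  assumes CC: "chain_complex sc C d"
begin

interpretation module sc by (rule chain_complexD(1)[OF CC])

private lemmas cc = chain_complexD[OF CC]
private lemmas closed = submod_on_closed[OF cc(2)]

context
  fixes H :: "int \<Rightarrow> 'm \<Rightarrow> 'm" and R :: "('n, 'a) laurent set"
  assumes H: "\<And>k. lin_on R sc sc (C k) (C (k + 1)) (H k)"
begin

lemma homotopy_prev: "lin_on R sc sc (C (k - 1)) (C k) (H (k - 1))"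
  using H[of "k - 1"] by simp

lemma homotopy_map_lin: "lin_on R sc sc (C k) (C k) (homotopy_map d H k)"
  unfolding lin_on_def
proof (intro conjI ballI)
  note Hp = homotopy_prev[of k]
  note dk = lin_onD(1)[OF cc(3)[of k]] and Hk = lin_onD(1)[OF H[of k]]
  fix x assume x: "x \<in> C k"
  show "homotopy_map d H k x \<in> C k"
    unfolding homotopy_map_def
    using x closed(4) lin_onD(1)[OF cc(5) Hk[OF x]] lin_onD(1)[OF Hp dk[OF x]] by blast
  show "homotopy_map d H k (sc r x) = sc r (homotopy_map d H k x)" if "r \<in> R" for r
    unfolding homotopy_map_def
    using x that dk[OF x] Hk[OF x]
    by (simp add: lin_onD(3)[OF H] lin_onD(3)[OF Hp] lin_onD(3)[OF cc(3)] lin_onD(3)[OF cc(5)]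
        scale_right_diff_distrib)
  fix y assume y: "y \<in> C k"
  show "homotopy_map d H k (x + y) = homotopy_map d H k x + homotopy_map d H k y"
    unfolding homotopy_map_def
    using x y dk[OF x] Hk[OF x] dk[OF y] Hk[OF y]
    by (simp add: lin_onD(2)[OF H] lin_onD(2)[OF Hp] lin_onD(2)[OF cc(3)] lin_onD(2)[OF cc(5)])
qed

text \<open>As \<open>d\<close> squares to zero and \<open>H\<close> preserves 0, both sides reduce
  to \<open>d - d H d\<close> applied to \<open>x\<close>.\<close>

lemma homotopy_map_chain:
  assumes x: "x \<in> C k"
  shows "d k (homotopy_map d H k x) = homotopy_map d H (k - 1) (d k x)"
proof -
  note Hp = homotopy_prev[of k]
  note dk = lin_onD(1)[OF cc(3)[of k]] and Hk = lin_onD(1)[OF H[of k]]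
  have "d k (homotopy_map d H k x) = d k x - d k (d (k + 1) (H k x)) - d k (H (k - 1) (d k x))"
    unfolding homotopy_map_def
    using x closed(4) lin_onD(1)[OF cc(5) Hk[OF x]] lin_onD(1)[OF Hp dk[OF x]]
    by (simp add: lin_on_diff[OF cc(3) cc(2)])
  moreover have "d k (d (k + 1) (H k x)) = 0" by (rule cc(6)[OF Hk[OF x]])
  moreover have "H (k - 1 - 1) (d (k - 1) (d k x)) = 0"
    using cc(4)[OF x] lin_on_zero[OF H closed(1)] by simp
  ultimately show ?thesis by (simp add: homotopy_map_def)
qed

end

text \<open>With T and T' the maps of \<open>H\<close> and \<open>H'\<close>, the composite T' T
  belongs to the homotopy H + H' T; the calculation uses that T commutes with
  \<open>d\<close>.\<close>

lemma homotopy_map_compose: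
  assumes H: "\<And>k. lin_on R sc sc (C k) (C (k + 1)) (H k)"
    and H': "\<And>k. lin_on R' sc sc (C k) (C (k + 1)) (H' k)" and x: "x \<in> C k"
  shows "homotopy_map d (\<lambda>k x. H k x + H' k (homotopy_map d H k x)) k x
    = homotopy_map d H' k (homotopy_map d H k x)"
proof -
  have Tx: "homotopy_map d H k x \<in> C k" by (rule lin_onD(1)[OF homotopy_map_lin[OF H] x])
  have "d (k + 1) (H k x + H' k (homotopy_map d H k x))
      = d (k + 1) (H k x) + d (k + 1) (H' k (homotopy_map d H k x))"
    by (rule lin_onD(2)[OF cc(3) lin_onD(1)[OF H x] lin_onD(1)[OF H' Tx]])
  then show ?thesis
    unfolding homotopy_map_def[of d "\<lambda>k x. H k x + H' k (homotopy_map d H k x)"]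
      homotopy_map_def[of d H' k "homotopy_map d H k x"] homotopy_map_chain[OF H x]
    by (simp add: homotopy_map_def[of d H k x])
qed

text \<open>If \<open>h\<close> is a null-homotopy of \<open>p\<close> and \<open>q\<close> is a left inverse of \<open>p\<close>, then the map
  \<open>1 - d h q - h q d\<close> vanishes on multiples of \<open>p\<close>, although \<open>q\<close> does not commute with \<open>d\<close>.\<close>

lemma homotopy_killing_multiples:
  assumes proj: "\<And>k. fg_projective sc (C k)" and p: "p \<in> laurent_sub j" "p \<noteq> 0"
    and null: "null_homotopic_by sc C d p h"
  shows "\<exists>H. (\<forall>k. lin_on (laurent_free_of {j}) sc sc (C k) (C (k + 1)) (H k)) \<and>
    (\<forall>k. \<forall>x\<in>C k. homotopy_map d H k (sc p x) = 0)"
proof -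
  obtain Q where Q_add: "\<And>u v. Q (u + v) = Q u + Q v"
    and Q_mult: "\<And>t u. (\<forall>m\<in>Poly_Mapping.keys t. m j = 0) \<Longrightarrow> Q (t * u) = t * Q u"
    and Q_inv: "\<And>u. Q (p * u) = u"
    by (rule laurent_division[OF p]) blast
  have "\<exists>q. lin_on (laurent_free_of {j}) sc sc (C k) (C k) q \<and> (\<forall>x\<in>C k. q (sc p x) = x)" for k
  proof -
    obtain m :: nat and a b where b: "\<And>l. l < m \<Longrightarrow> b l \<in> C k"
      and a_add: "\<And>l x y. x \<in> C k \<Longrightarrow> y \<in> C k \<Longrightarrow> a l (x + y) = a l x + a l y"
      and a_sc: "\<And>l r x. x \<in> C k \<Longrightarrow> a l (sc r x) = r * a l x"
      and ab: "\<And>x. x \<in> C k \<Longrightarrow> x = (\<Sum>l<m. sc (a l x) (b l))"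
      by (rule fg_projective_dual_basis[OF proj[of k]]) blast
    \<comment> \<open>The division \<open>Q\<close> is applied to the coordinates. Reassembling them
      gives a left inverse of \<open>p\<close> on \<open>C k\<close>, linear over the variables
      other than z_j.\<close>
    define q where "q x = (\<Sum>l<m. sc (Q (a l x)) (b l))" for x
    have "q x \<in> C k" for x
      unfolding q_def using b by (intro submod_on_sum[OF cc(2)] closed(5)) auto
    moreover have "q (sc p x) = x" if "x \<in> C k" for x
      using ab[OF that] by (simp add: q_def a_sc that Q_inv)
    moreover have "q (sc t x) = sc t (q x)" if "t \<in> laurent_free_of {j}" "x \<in> C k" for t x
      using that by (simp add: q_def a_sc Q_mult laurent_free_of_def scale_sum_right)
    moreover have "q (x + y) = q x + q y" if "x \<in> C k" "y \<in> C k" for x y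
      using that by (simp add: q_def a_add Q_add scale_left_distrib sum.distrib)
    ultimately show ?thesis unfolding lin_on_def by blast
  qed
  then obtain q where q: "\<And>k. lin_on (laurent_free_of {j}) sc sc (C k) (C k) (q k)"
    and qp: "\<And>k x. x \<in> C k \<Longrightarrow> q k (sc p x) = x" by metis
  have h: "\<And>k. lin_on UNIV sc sc (C k) (C (k + 1)) (h k)"
    and ph: "\<And>k x. x \<in> C k \<Longrightarrow> sc p x = d (k + 1) (h k x) + h (k - 1) (d k x)"
    using null unfolding null_homotopic_by_def by blast+
  define H where "H k x = h k (q k x)" for k x
  have "lin_on (laurent_free_of {j}) sc sc (C k) (C (k + 1)) (H k)" for k
    unfolding lin_on_def H_def using lin_onD[OF h] lin_onD[OF q] by simp
  \<comment> \<open>Because \<open>d\<close> commutes with \<open>p\<close>, both occurrences of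
    \<open>q\<close> meet a multiple of \<open>p\<close> and cancel it, leaving the null-homotopy
    identity of \<open>h\<close>.\<close>
  moreover have "homotopy_map d H k (sc p x) = 0" if x: "x \<in> C k" for k x
  proof -
    have "d k (sc p x) = sc p (d k x)" using lin_onD(3)[OF cc(3)] x by simp
    then have "homotopy_map d H k (sc p x) = sc p x - d (k + 1) (h k x) - h (k - 1) (d k x)"
      by (simp add: homotopy_map_def H_def qp x lin_onD(1)[OF cc(3)])
    then show ?thesis using ph[OF x] by simp
  qed
  ultimately show ?thesis by blast
qed

lemma homotopy_killing_all_multiples:
  assumes proj: "\<And>k. fg_projective sc (C k)"
    and p: "\<And>j. p j \<in> laurent_sub j" "\<And>j. p j \<noteq> 0" "\<And>j. null_homotopic_by sc C d (p j) (h j)"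
    and "finite J"
  shows "\<exists>H. (\<forall>k. lin_on (laurent_free_of J) sc sc (C k) (C (k + 1)) (H k)) \<and>
    (\<forall>j\<in>J. \<forall>k. \<forall>x\<in>C k. homotopy_map d H k (sc (p j) x) = 0)"
  using \<open>finite J\<close>
proof induction
  case empty
  have "lin_on (laurent_free_of {}) sc sc (C k) (C (k + 1)) (\<lambda>_. 0)" for k
    using closed(1) by (auto simp: lin_on_def)
  then show ?case by (intro exI[of _ "\<lambda>_ _. 0"]) simp
next
  case (insert j J)
  then obtain H where H: "\<And>k. lin_on (laurent_free_of J) sc sc (C k) (C (k + 1)) (H k)"
    and HJ: "\<And>i k x. i \<in> J \<Longrightarrow> x \<in> C k \<Longrightarrow> homotopy_map d H k (sc (p i) x) = 0" by blast
  obtain H' where H': "\<And>k. lin_on (laurent_free_of {j}) sc sc (C k) (C (k + 1)) (H' k)"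
    and Hj: "\<And>k x. x \<in> C k \<Longrightarrow> homotopy_map d H' k (sc (p j) x) = 0"
    using homotopy_killing_multiples[OF proj p] by metis
  let ?T = "homotopy_map d H" and ?T' = "homotopy_map d H'"
  let ?H = "\<lambda>k x. H k x + H' k (?T k x)"
  note T = homotopy_map_lin[OF H] and T' = homotopy_map_lin[OF H']
  \<comment> \<open>Since \<open>j\<close> lies outside \<open>J\<close>, the map \<open>?T\<close>
    commutes with \<open>p j\<close>, although it is not L-linear in general.\<close>
  have pj: "p j \<in> laurent_free_of J"
    using p(1)[of j] insert.hyps by (auto simp: laurent_free_of_def laurent_sub_def)
  have "lin_on (laurent_free_of (insert j J)) sc sc (C k) (C (k + 1)) (?H k)" for k
  proof -
    have sub: "t \<in> laurent_free_of J" "t \<in> laurent_free_of {j}" if "t \<in> laurent_free_of (insert j J)"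
      for t :: "('n, 'a) laurent"
      using that by (auto simp: laurent_free_of_def)
    show ?thesis
      unfolding lin_on_def using closed(2) lin_onD[OF H] lin_onD[OF H'] lin_onD[OF T] sub
      by (simp add: scale_right_distrib)
  qed
  moreover have "homotopy_map d ?H k (sc (p i) x) = 0" if i: "i \<in> insert j J" and x: "x \<in> C k" for i k x
  proof -
    have "homotopy_map d ?H k (sc (p i) x) = ?T' k (?T k (sc (p i) x))"
      by (rule homotopy_map_compose[OF H H' closed(5)[OF UNIV_I x]])
    \<comment> \<open>For \<open>i = j\<close>, the factor \<open>p j\<close> passes through
      \<open>?T\<close> and is killed by \<open>?T'\<close>; for \<open>i\<close> in
      \<open>J\<close>, already \<open>?T\<close> gives 0.\<close>
    also have "\<dots> = 0"
    proof (cases "i = j")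
      case True
      then show ?thesis
        using lin_onD(3)[OF T pj x] Hj[OF lin_onD(1)[OF T x]] by simp
    next
      case False
      then show ?thesis
        using HJ[OF _ x] i lin_on_zero[OF T' closed(1)] by simp
    qed
    finally show ?thesis .
  qed
  ultimately show ?case by (intro exI[of _ ?H]) blast
qed

end

section \<open>Finite-dimensionality\<close>

text \<open>A two-sided linear recurrence is determined by \<open>degree P\<close> consecutive
  terms: the leading coefficient solves for the next term, the nonzero constant coefficient for the
  preceding one.\<close>

lemma (in vector_space) recurrence_in_subspace:
  fixes v :: "int \<Rightarrow> 'b" and P :: "'a poly"
  assumes W: "subspace W" and P: "coeff P 0 \<noteq> 0"
    and rec: "\<And>t. (\<Sum>i\<le>degree P. scale (coeff P i) (v (t + int i))) = 0"
    and init: "\<And>t. 0 \<le> t \<Longrightarrow> t < int (degree P) \<Longrightarrow> v t \<in> W"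
  shows "v t \<in> W"
proof -
  define D where "D = degree P"
  have solve: "v (t + int l) \<in> W"
    if l: "l \<le> D" "coeff P l \<noteq> 0" and others: "\<And>i. i \<le> D \<Longrightarrow> i \<noteq> l \<Longrightarrow> v (t + int i) \<in> W" for t l
  proof -
    have "(\<Sum>i\<le>D. scale (coeff P i) (v (t + int i)))
      = scale (coeff P l) (v (t + int l)) + (\<Sum>i\<in>{..D} - {l}. scale (coeff P i) (v (t + int i)))"
      using l by (simp add: sum.remove)
    then have "scale (coeff P l) (v (t + int l)) = - (\<Sum>i\<in>{..D} - {l}. scale (coeff P i) (v (t + int i)))"
      using rec[of t] by (simp add: D_def eq_neg_iff_add_eq_0)
    also have "\<dots> \<in> W"
      using others by (intro subspace_neg[OF W] subspace_sum[OF W] subspace_scale[OF W]) auto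
    finally have "scale (inverse (coeff P l)) (scale (coeff P l) (v (t + int l))) \<in> W"
      by (rule subspace_scale[OF W])
    then show ?thesis using l by simp
  qed
  \<comment> \<open>The window of indices known to be good grows by one at each end. For a constant
    \<open>P\<close> it starts empty, and the recurrence itself forces the new terms to be
    0.\<close>
  have "\<forall>t. - int n \<le> t \<longrightarrow> t < int D + int n \<longrightarrow> v t \<in> W" for n
  proof (induction n)
    case 0
    then show ?case using init by (simp add: D_def)
  next
    case (Suc n)
    have lead: "coeff P D \<noteq> 0" using P by (auto simp: D_def)
    have "v (int n + int D) \<in> W"
      by (rule solve) (simp_all add: lead Suc)
    moreover have "v (- int n - 1 + int 0) \<in> W"
      by (rule solve) (simp_all add: P Suc)
    ultimately have "v (int D + int n) \<in> W" "v (- int n - 1) \<in> W" by (simp_all add: add.commute)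
    moreover have "t = int D + int n \<or> t = - int n - 1 \<or> - int n \<le> t \<and> t < int D + int n"
      if "- int (Suc n) \<le> t" "t < int D + int (Suc n)" for t
      using that by linarith
    ultimately show ?case using Suc by blast
  qed
  from this[of "nat \<bar>t\<bar> + 1"] show ?thesis by auto
qed

text \<open>The box constraints are lifted one coordinate at a time; \<open>J\<close> collects the
  coordinates that are already unrestricted.\<close>

lemma (in vector_space) multi_recurrence_in_subspace:
  fixes w :: "('n::finite \<Rightarrow> int) \<Rightarrow> 'b" and P :: "'n \<Rightarrow> 'a poly"
  assumes W: "subspace W" and P: "\<And>j. coeff (P j) 0 \<noteq> 0"
    and rec: "\<And>j m. (\<Sum>i\<le>degree (P j). scale (coeff (P j) i) (w (m + var_exp j (int i)))) = 0"
    and init: "\<And>m. (\<forall>j. 0 \<le> m j \<and> m j < int (degree (P j))) \<Longrightarrow> w m \<in> W"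
  shows "w m \<in> W"
proof -
  have "\<forall>m. (\<forall>j. j \<notin> J \<longrightarrow> 0 \<le> m j \<and> m j < int (degree (P j))) \<longrightarrow> w m \<in> W" if "finite J" for J
    using that
  proof induction
    case empty
    then show ?case using init by simp
  next
    case (insert j J)
    show ?case
    proof (intro allI impI)
      fix m assume m: "\<forall>i. i \<notin> insert j J \<longrightarrow> 0 \<le> m i \<and> m i < int (degree (P i))"
      have "w (m(j := t)) \<in> W" for t
      proof (rule recurrence_in_subspace[OF W P[of j]])
        fix t
        have "m(j := t + int i) = m(j := t) + var_exp j (int i)" for i
          by (auto simp: fun_eq_iff var_exp_def)
        then show "(\<Sum>i\<le>degree (P j). scale (coeff (P j) i) (w (m(j := t + int i)))) = 0"
          using rec[of j "m(j := t)"] by simp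
      next
        fix t assume t: "0 \<le> t" "t < int (degree (P j))"
        have "\<forall>i. i \<notin> J \<longrightarrow> 0 \<le> (m(j := t)) i \<and> (m(j := t)) i < int (degree (P i))"
          using m t by auto
        then show "w (m(j := t)) \<in> W" using insert.IH by blast
      qed
      from this[of "m j"] show "w m \<in> W" by simp
    qed
  qed
  from this[of UNIV] show ?thesis by simp
qed

text \<open>For fixed \<open>y\<close>, the vanishing of \<open>T\<close> on multiples of each
  \<open>p j\<close> is a recurrence in direction j for the values of \<open>T\<close> on all
  monomial multiples of \<open>y\<close>. Hence the monomials in a finite box span these values, and
  \<open>y\<close> need only run over finitely many generators.\<close>

lemma finite_span_of_killed_multiples:
  fixes sc :: "('n::finite, 'a::field) laurent \<Rightarrow> 'm::ab_group_add \<Rightarrow> 'm"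
  assumes sc: "module sc" and A: "submod_on UNIV sc A" and proj: "fg_projective sc A"
    and T: "lin_on (range lconst) sc sc A A T"
    and p: "\<And>j. p j \<in> laurent_sub j" "\<And>j. p j \<noteq> 0"
    and kill: "\<And>j x. x \<in> A \<Longrightarrow> T (sc (p j) x) = 0"
  shows "\<exists>E. finite E \<and> T ` A \<subseteq> module.span (\<lambda>c. sc (lconst c)) E"
proof -
  interpret module sc by (rule sc)
  interpret F: vector_space "\<lambda>c. sc (lconst c)" by (rule vector_space_lconst[OF sc])
  note closed = submod_on_closed[OF A]
  have "\<forall>j. \<exists>a P. coeff P 0 \<noteq> 0 \<and> p j = Poly_Mapping.single (var_exp j a) 1 * laurent_of_poly j P"
    using laurent_sub_factor[OF p] by metis
  then obtain a P where P: "\<And>j. coeff (P j) 0 \<noteq> 0"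
    and pP: "\<And>j. p j = Poly_Mapping.single (var_exp j (a j)) 1 * laurent_of_poly j (P j)"
    by metis
  \<comment> \<open>The monomial unit in \<open>p j\<close> is absorbed into the argument, leaving
    the polynomial factor.\<close>
  have killP: "T (sc (laurent_of_poly j (P j)) x) = 0" if x: "x \<in> A" for j x
  proof -
    let ?x = "sc (Poly_Mapping.single (var_exp j (- a j)) 1) x"
    have "sc (p j) ?x = sc (laurent_of_poly j (P j)
        * (Poly_Mapping.single (var_exp j (a j)) 1 * Poly_Mapping.single (var_exp j (- a j)) 1)) x"
      by (simp add: pP ac_simps)
    also have "\<dots> = sc (laurent_of_poly j (P j)) x"
      by (simp add: mult_single var_exp_add)
    finally show ?thesis using kill[of ?x j] closed(5)[OF UNIV_I x] by simp
  qed
  define Box where "Box = {m :: 'n \<Rightarrow> int. \<forall>j. 0 \<le> m j \<and> m j < int (degree (P j))}"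
  have "Box \<subseteq> {m. \<forall>j. (j \<in> UNIV \<longrightarrow> m j \<in> (\<Union>j. {0..<int (degree (P j))})) \<and> (j \<notin> UNIV \<longrightarrow> m j = 0)}"
    by (auto simp: Box_def)
  then have Box: "finite Box" by (rule finite_subset) (intro finite_set_of_finite_funs, auto)
  define E where "E y = (\<lambda>m. T (sc (Poly_Mapping.single m 1) y)) ` Box" for y
  have E: "T (sc s y) \<in> F.span (E y)" if y: "y \<in> A" for s y
  proof -
    have mono: "T (sc (Poly_Mapping.single m 1) y) \<in> F.span (E y)" for m
    proof (rule F.multi_recurrence_in_subspace[where P = P and w = "\<lambda>m. T (sc (Poly_Mapping.single m 1) y)"])
      fix j m
      let ?y = "sc (Poly_Mapping.single m 1) y"
      have "0 = T (sc (laurent_of_poly j (P j)) ?y)"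
        using killP[OF closed(5)[OF UNIV_I y]] by simp
      also have "sc (laurent_of_poly j (P j)) ?y
          = (\<Sum>i\<le>degree (P j). sc (lconst (coeff (P j) i)) (sc (Poly_Mapping.single (m + var_exp j (int i)) 1) y))"
        by (simp add: laurent_of_poly_def scale_sum_left sum_distrib_right mult_single lconst_def add.commute)
      also have "T \<dots> = (\<Sum>i\<le>degree (P j). T (sc (lconst (coeff (P j) i)) (sc (Poly_Mapping.single (m + var_exp j (int i)) 1) y)))"
        by (rule lin_on_sum[OF T A]) (rule closed(5)[OF UNIV_I closed(5)[OF UNIV_I y]])
      finally show "(\<Sum>i\<le>degree (P j). sc (lconst (coeff (P j) i)) (T (sc (Poly_Mapping.single (m + var_exp j (int i)) 1) y))) = 0"
        by (simp add: lin_onD(3)[OF T _ closed(5)[OF UNIV_I y]] del: scale_scale)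
    next
      fix m assume "\<forall>j. 0 \<le> m j \<and> m j < int (degree (P j))"
      then show "T (sc (Poly_Mapping.single m 1) y) \<in> F.span (E y)"
        by (intro F.span_base) (auto simp: E_def Box_def)
    qed (use P in \<open>simp_all add: F.subspace_span\<close>)
    show ?thesis
    proof (induction s rule: poly_mapping_additive_induct)
      case (single m c)
      have "sc (Poly_Mapping.single m c) y = sc (lconst c) (sc (Poly_Mapping.single m 1) y)"
        by (simp add: single_eq_lconst_mult[of m c])
      then show ?case
        using F.span_scale[OF mono[of m], of c] lin_onD(3)[OF T rangeI closed(5)[OF UNIV_I y]]
        by (simp del: scale_scale)
    next
      case (add s t)
      then show ?case
        using F.span_add lin_onD(2)[OF T closed(5)[OF UNIV_I y] closed(5)[OF UNIV_I y]]
        by (simp add: scale_left_distrib)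
    qed
  qed
  obtain m :: nat and c b where b: "\<And>l. l < m \<Longrightarrow> b l \<in> A"
    and cb: "\<And>x. x \<in> A \<Longrightarrow> x = (\<Sum>l<m. sc (c l x) (b l))"
    by (rule fg_projective_dual_basis[OF proj]) blast
  have "T x \<in> F.span (\<Union>l<m. E (b l))" if x: "x \<in> A" for x
  proof -
    have "T x = T (\<Sum>l<m. sc (c l x) (b l))" using cb[OF x] by simp
    also have "\<dots> = (\<Sum>l<m. T (sc (c l x) (b l)))"
      using b closed(5) by (intro lin_on_sum[OF T A]) auto
    also have "\<dots> \<in> F.span (\<Union>l<m. E (b l))"
    proof (rule F.span_sum)
      fix l assume "l \<in> {..<m}"
      then show "T (sc (c l x) (b l)) \<in> F.span (\<Union>l<m. E (b l))"
        using E[OF b, of l] F.span_mono[of "E (b l)" "\<Union>l<m. E (b l)"] by blast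
    qed
    finally show ?thesis .
  qed
  moreover have "finite (\<Union>l<m. E (b l))" using Box by (simp add: E_def)
  ultimately show ?thesis by blast
qed

text \<open>Coordinates with respect to a basis of \<open>V\<close>. The last clause keeps the
  complex assembled from these spaces bounded.\<close>

lemma (in vector_space) finite_dimensional_coordinates:
  assumes V: "subspace V" "V \<subseteq> span E" "finite E"
  shows "\<exists>n g. lin_on UNIV coord_scale scale (free_mod n) V g \<and> bij_betw g (free_mod n) V \<and>
    (V = {0} \<longrightarrow> n = 0)"
proof -
  obtain B where B: "B \<subseteq> V" "independent B" "V \<subseteq> span B"
    using maximal_independent_subset[of V] by blast
  have finB: "finite B" using independent_span_bound[OF V(3) B(2)] B(1) V(2) by blast
  have spanB: "span B = V" using B span_minimal[OF B(1) V(1)] by blast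
  define n where "n = card B"
  obtain b where b: "bij_betw b {..<n} B"
    using ex_bij_betw_nat_finite[OF finB] by (auto simp: n_def atLeast0LessThan)
  then have inj: "inj_on b {..<n}" and bB: "b ` {..<n} = B" by (auto simp: bij_betw_def)
  define g where "g y = (\<Sum>i<n. scale (y i) (b i))" for y
  have gV: "g y \<in> V" for y
    unfolding g_def spanB[symmetric] using bB by (intro span_sum span_scale span_base) auto
  have "lin_on UNIV coord_scale scale (free_mod n) V g"
    unfolding lin_on_def using gV
    by (auto simp: g_def coord_scale_def scale_left_distrib sum.distrib scale_sum_right)
  moreover have "inj_on g (free_mod n)"
  proof (rule inj_onI)
    fix y y' assume y: "y \<in> free_mod n" "y' \<in> free_mod n" "g y = g y'"
    define u where "u v = y (the_inv_into {..<n} b v) - y' (the_inv_into {..<n} b v)" for v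
    have u: "u (b i) = y i - y' i" if "i < n" for i
      using that by (simp add: u_def the_inv_into_f_f[OF inj])
    have "(\<Sum>v\<in>B. scale (u v) v) = (\<Sum>i<n. scale (u (b i)) (b i))"
      by (simp add: sum.reindex[OF inj] flip: bB)
    also have "\<dots> = g y - g y'" by (simp add: u g_def scale_left_diff_distrib sum_subtractf)
    finally have "(\<Sum>v\<in>B. scale (u v) v) = 0" using y(3) by simp
    then have uB: "u v = 0" if "v \<in> B" for v
      using B(2) that unfolding dependent_finite[OF finB] by blast
    show "y = y'"
    proof
      fix i
      show "y i = y' i"
        using u[of i] uB[of "b i"] bB y(1,2) by (cases "i < n") (auto simp: free_mod_def)
    qed
  qed
  moreover have "V \<subseteq> g ` free_mod n"
  proof
    fix v assume "v \<in> V"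
    then obtain u where u: "v = (\<Sum>v\<in>B. scale (u v) v)"
      using spanB span_finite[OF finB] by auto
    define y where "y i = (if i < n then u (b i) else 0)" for i
    have "v = g y" by (simp add: u g_def y_def sum.reindex[OF inj] flip: bB)
    moreover have "y \<in> free_mod n" by (simp add: y_def free_mod_def)
    ultimately show "v \<in> g ` free_mod n" by blast
  qed
  moreover have "n = 0" if "V = {0}"
  proof -
    have "0 \<notin> B" using B(2) dependent_zero by blast
    then have "B = {}" using B(1) that by blast
    then show ?thesis by (simp add: n_def)
  qed
  ultimately show ?thesis using gV by (intro exI[of _ n] exI[of _ g]) (auto simp: bij_betw_def)
qed

section \<open>Splitting off the homology over the field\<close>

context
  fixes sc :: "('n, 'a::field) laurent \<Rightarrow> 'm::ab_group_add \<Rightarrow> 'm"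
    and C :: "int \<Rightarrow> 'm set" and d :: "int \<Rightarrow> 'm \<Rightarrow> 'm"
  assumes CC: "chain_complex sc C d"
begin

private lemmas cc' = chain_complexD[OF CC]
private lemmas closed' = submod_on_closed[OF cc'(2)]

interpretation module sc by (rule cc'(1))
interpretation F: vector_space "\<lambda>c. sc (lconst c)" by (rule vector_space_lconst[OF cc'(1)])

lemma F_subspace: "F.subspace (C k)"
  using closed' by (simp add: F.subspace_def)

text \<open>Preimages are chosen for a basis of the boundaries and extended F-linearly.\<close>

lemma boundary_section:
  "\<exists>h. lin_on (range lconst) sc sc (C k) (C (k + 1)) h \<and>
    (\<forall>x\<in>C (k + 1). d (k + 1) (h (d (k + 1) x)) = d (k + 1) x)"
proof -
  interpret FF: vector_space_pair "\<lambda>c. sc (lconst c)" "\<lambda>c. sc (lconst c)" by unfold_locales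
  note dk = cc'(5)[of k]
  obtain B where B: "B \<subseteq> d (k + 1) ` C (k + 1)" "F.independent B" "d (k + 1) ` C (k + 1) \<subseteq> F.span B"
    using F.maximal_independent_subset[of "d (k + 1) ` C (k + 1)"] by blast
  define g where "g = inv_into (C (k + 1)) (d (k + 1))"
  have g: "g y \<in> C (k + 1)" "d (k + 1) (g y) = y" if "y \<in> B" for y
    using B(1) that unfolding g_def by (blast intro: inv_into_into f_inv_into_f)+
  define h where "h = FF.construct B g"
  interpret h: Vector_Spaces.linear "\<lambda>c. sc (lconst c)" "\<lambda>c. sc (lconst c)" h
    unfolding h_def by (rule FF.linear_construct[OF B(2)])
  have hC: "h y \<in> C (k + 1)" for y
  proof -
    have "h y \<in> F.span (g ` B)" unfolding h_def by (rule FF.construct_in_span[OF B(2)])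
    moreover have "F.span (g ` B) \<subseteq> C (k + 1)" using g by (intro F.span_minimal F_subspace) auto
    ultimately show ?thesis by blast
  qed
  have "F.subspace {y. d (k + 1) (h y) = y}"
    using lin_on_zero[OF dk closed'(1)] lin_onD(2)[OF dk] lin_onD(3)[OF dk] hC
    by (simp add: F.subspace_def h.zero h.add h.scale)
  moreover have "B \<subseteq> {y. d (k + 1) (h y) = y}"
    using g by (auto simp: h_def FF.construct_basis[OF B(2)])
  ultimately have "F.span B \<subseteq> {y. d (k + 1) (h y) = y}" by (intro F.span_minimal)
  then have "\<forall>x\<in>C (k + 1). d (k + 1) (h (d (k + 1) x)) = d (k + 1) x" using B(3) by blast
  moreover have "lin_on (range lconst) sc sc (C k) (C (k + 1)) h"
    using hC by (auto simp: lin_on_def h.add h.scale)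
  ultimately show ?thesis by blast
qed

text \<open>A section \<open>h\<^sub>0\<close> of the differential is improved to \<open>h\<^sub>1 = h\<^sub>0 d h\<^sub>0\<close>, so that \<open>h\<^sub>1 d h\<^sub>1 = h\<^sub>1\<close>, and
  then to \<open>h = h\<^sub>1 - h\<^sub>1 h\<^sub>1 d\<close>, so that also \<open>h h = 0\<close>; these identities make \<open>1 - d h - h d\<close>
  idempotent.\<close>

lemma homology_projection:
  obtains h where "\<And>k. lin_on (range lconst) sc sc (C k) (C (k + 1)) (h k)"
    "\<And>k x. x \<in> C k \<Longrightarrow> d k (homotopy_map d h k x) = 0"
    "\<And>k x. x \<in> C (k + 1) \<Longrightarrow> homotopy_map d h k (d (k + 1) x) = 0"
    "\<And>k x. x \<in> C k \<Longrightarrow> homotopy_map d h k (homotopy_map d h k x) = homotopy_map d h k x"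
proof -
  have "\<forall>k. \<exists>h. lin_on (range lconst) sc sc (C k) (C (k + 1)) h \<and>
      (\<forall>x\<in>C (k + 1). d (k + 1) (h (d (k + 1) x)) = d (k + 1) x)"
    using boundary_section by blast
  from choice[OF this] obtain h0 where
    h0: "\<And>k. lin_on (range lconst) sc sc (C k) (C (k + 1)) (h0 k)" and
    dh0: "\<And>k x. x \<in> C (k + 1) \<Longrightarrow> d (k + 1) (h0 k (d (k + 1) x)) = d (k + 1) x"
    by blast
  note dC = lin_onD(1)[OF cc'(3)] and dC' = lin_onD(1)[OF cc'(5)]
  define h1 where "h1 k x = h0 k (d (k + 1) (h0 k x))" for k x
  have h1: "lin_on (range lconst) sc sc (C k) (C (k + 1)) (h1 k)" for k
    unfolding lin_on_def h1_def
    using lin_onD[OF h0[of k]] lin_onD[OF cc'(5)[of k]] by simp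
  have dh1: "d (k + 1) (h1 k (d (k + 1) x)) = d (k + 1) x" if "x \<in> C (k + 1)" for k x
    using that lin_onD(1)[OF h0[of k]] dC' by (simp add: h1_def dh0)
  have h1dh1: "h1 k (d (k + 1) (h1 k x)) = h1 k x" if "x \<in> C k" for k x
    using that lin_onD(1)[OF h0[of k]] dC' by (simp add: h1_def dh0)
  have h1': "lin_on (range lconst) sc sc (C (k - 1)) (C k) (h1 (k - 1))" for k
    using h1[of "k - 1"] by simp
  define h where "h k x = h1 k x - h1 k (h1 (k - 1) (d k x))" for k x
  have hhd: "h1 k (h1 (k - 1) (d k x)) \<in> C (k + 1)" "h1 (k - 1) (d k x) \<in> C k" if "x \<in> C k" for k x
    using lin_onD(1)[OF h1'[of k] dC[OF that]] lin_onD(1)[OF h1] by blast+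
  have h: "lin_on (range lconst) sc sc (C k) (C (k + 1)) (h k)" for k
    unfolding lin_on_def
  proof (intro conjI ballI)
    fix x assume x: "x \<in> C k"
    show "h k x \<in> C (k + 1)"
      unfolding h_def using closed'(4) lin_onD(1)[OF h1 x] hhd(1)[OF x] by blast
    show "h k (sc r x) = sc r (h k x)" if "r \<in> range lconst" for r
      using x that dC[OF x] hhd(2)[OF x]
      by (simp add: h_def lin_onD(3)[OF h1] lin_onD(3)[OF cc'(3)] lin_onD(3)[OF h1'] scale_right_diff_distrib)
    fix y assume y: "y \<in> C k"
    show "h k (x + y) = h k x + h k y"
      using x y dC[OF x] dC[OF y] hhd(2)[OF x] hhd(2)[OF y]
      by (simp add: h_def lin_onD(2)[OF h1] lin_onD(2)[OF cc'(3)] lin_onD(2)[OF h1'])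
  qed
  have hd: "h k (d (k + 1) x) = h1 k (d (k + 1) x)" if "x \<in> C (k + 1)" for k x
    using cc'(6)[OF that] lin_on_zero[OF h1 closed'(1)] by (simp add: h_def)
  \<comment> \<open>Together with \<open>hd\<close>, this yields both h d h = h and h h = 0 in
    \<open>Ph\<close>.\<close>
  have h1dh: "h1 k (d (k + 1) (h k x)) = h k x" if x: "x \<in> C k" for k x
  proof -
    have y: "h1 (k - 1) (d k x) \<in> C k" by (rule hhd(2)[OF x])
    have "d (k + 1) (h k x) = d (k + 1) (h1 k x) - d (k + 1) (h1 k (h1 (k - 1) (d k x)))"
      unfolding h_def by (rule lin_on_diff[OF cc'(3) cc'(2) lin_onD(1)[OF h1 x] hhd(1)[OF x]])
    then have "h1 k (d (k + 1) (h k x))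
        = h1 k (d (k + 1) (h1 k x)) - h1 k (d (k + 1) (h1 k (h1 (k - 1) (d k x))))"
      using lin_on_diff[OF h1 cc'(2) dC'[OF lin_onD(1)[OF h1 x]] dC'[OF hhd(1)[OF x]]] by simp
    then show ?thesis by (simp add: h1dh1[OF x] h1dh1[OF y] h_def)
  qed
  let ?P = "homotopy_map d h"
  have P: "lin_on (range lconst) sc sc (C k) (C k) (?P k)" for k
    by (rule homotopy_map_lin[OF CC h])
  have Pd: "?P k (d (k + 1) x) = 0" if x: "x \<in> C (k + 1)" for k x
    using cc'(6)[OF x] lin_on_zero[OF h closed'(1)]
    by (simp add: homotopy_map_def hd[OF x] dh1[OF x])
  have dP: "d k (?P k x) = 0" if x: "x \<in> C k" for k x
    using homotopy_map_chain[OF CC h x] Pd[of x "k - 1"] x by simp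
  have Ph: "?P (k + 1) (h k x) = 0" if x: "x \<in> C k" for k x
  proof -
    have hx: "h k x \<in> C (k + 1)" by (rule lin_onD(1)[OF h x])
    have "h (k + 1) (h k x) = 0"
      using h1dh[OF x] by (simp add: h_def[of "k + 1"])
    moreover have "h k (d (k + 1) (h k x)) = h k x" using hd[OF hx] h1dh[OF x] by simp
    ultimately show ?thesis
      using lin_on_zero[OF cc'(3) closed'(1)] by (simp add: homotopy_map_def)
  qed
  \<comment> \<open>Expanding the inner \<open>?P\<close> leaves \<open>?P k x\<close>, since
    \<open>?P\<close> vanishes on boundaries by \<open>Pd\<close> and on values of \<open>h\<close>
    by \<open>Ph\<close>.\<close>
  have PP: "?P k (?P k x) = ?P k x" if x: "x \<in> C k" for k x
  proof -
    have 1: "d (k + 1) (h k x) \<in> C k" by (rule dC'[OF lin_onD(1)[OF h x]])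
    have 2: "h (k - 1) (d k x) \<in> C k" using lin_onD(1)[OF h dC[OF x]] by simp
    have "?P k (x - d (k + 1) (h k x) - h (k - 1) (d k x))
        = ?P k x - ?P k (d (k + 1) (h k x)) - ?P k (h (k - 1) (d k x))"
      by (simp only: lin_on_diff[OF P cc'(2)] x 1 2 closed'(4))
    then have "?P k (?P k x) = ?P k x - ?P k (d (k + 1) (h k x)) - ?P k (h (k - 1) (d k x))"
      by (simp only: homotopy_map_def[of d h k x, symmetric])
    then show ?thesis
      using Pd[OF lin_onD(1)[OF h x]] Ph[OF dC[OF x]] by simp
  qed
  show ?thesis by (rule that[OF h dP Pd PP])
qed

lemma lin_on_lconst_iff:
  "lin_on UNIV (\<lambda>c. sc (lconst c)) (\<lambda>c. sc (lconst c)) A B f \<longleftrightarrow> lin_on (range lconst) sc sc A B f"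
  by (auto simp: lin_on_def)

text \<open>The map of \<open>H\<close> is homotopic to the identity, so it induces the identity on
  homology; having finite rank, it forces the homology to be finite-dimensional. The complex then
  retracts onto its homology by \<open>homology_projection\<close>.\<close>

lemma finitely_dominated_if_finite_rank_homotopy:
  assumes bd: "bounded_complex C"
    and H: "\<And>k. lin_on (range lconst) sc sc (C k) (C (k + 1)) (H k)"
    and fin: "\<And>k. \<exists>E. finite E \<and> homotopy_map d H k ` C k \<subseteq> F.span E"
  shows "F_finitely_dominated sc C d"
proof -
  obtain h where h: "\<And>k. lin_on (range lconst) sc sc (C k) (C (k + 1)) (h k)"
    and dP: "\<And>k x. x \<in> C k \<Longrightarrow> d k (homotopy_map d h k x) = 0"
    and Pd: "\<And>k x. x \<in> C (k + 1) \<Longrightarrow> homotopy_map d h k (d (k + 1) x) = 0"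
    and PP: "\<And>k x. x \<in> C k \<Longrightarrow> homotopy_map d h k (homotopy_map d h k x) = homotopy_map d h k x"
    by (rule homology_projection) blast
  let ?P = "homotopy_map d h" and ?T = "homotopy_map d H"
  have P: "lin_on (range lconst) sc sc (C k) (C k) (?P k)" for k
    by (rule homotopy_map_lin[OF CC h])
  have T: "lin_on (range lconst) sc sc (C k) (C k) (?T k)" for k
    by (rule homotopy_map_lin[OF CC H])
  \<comment> \<open>\<open>V k\<close> consists of cycles, one representing each homology class of
    degree \<open>k\<close>.\<close>
  define V where "V k = ?P k ` C k" for k
  have image_subspace: "F.subspace (f ` C k)" if f: "lin_on (range lconst) sc sc (C k) (C k) f" for f k
    unfolding F.subspace_def
  proof (intro conjI ballI allI)
    show "0 \<in> f ` C k" using lin_on_zero[OF f closed'(1)] closed'(1) by force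
  next
    fix x y assume "x \<in> f ` C k" "y \<in> f ` C k"
    then show "x + y \<in> f ` C k" by (auto simp flip: lin_onD(2)[OF f] intro: closed')
  next
    fix c x assume "x \<in> f ` C k"
    then obtain y where y: "y \<in> C k" "x = f y" by blast
    have "sc (lconst c) x = f (sc (lconst c) y)" using lin_onD(3)[OF f _ y(1)] y(2) by simp
    then show "sc (lconst c) x \<in> f ` C k" using closed'(5)[OF UNIV_I y(1)] by blast
  qed
  have "\<exists>E. finite E \<and> V k \<subseteq> F.span E" for k
  proof -
    obtain E where E: "finite E" "?T k ` C k \<subseteq> F.span E" using fin by blast
    \<comment> \<open>The spanning set \<open>E\<close> may lie outside \<open>C k\<close>, where
      \<open>?P\<close> is not controlled; a basis inside the image of \<open>?T\<close> avoids
      this.\<close>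
    obtain B where B: "B \<subseteq> ?T k ` C k" "F.independent B" "?T k ` C k \<subseteq> F.span B"
      using F.maximal_independent_subset[of "?T k ` C k"] by blast
    have "finite B" using F.independent_span_bound[OF E(1) B(2)] B(1) E(2) by blast
    have BC: "B \<subseteq> C k" using B(1) lin_onD(1)[OF T] by blast
    let ?S = "{y \<in> C k. ?P k y \<in> F.span (?P k ` B)}"
    have "F.subspace ?S"
      using closed' lin_on_zero[OF P closed'(1)] F.span_zero F.span_add F.span_scale
      by (simp add: F.subspace_def lin_onD(2)[OF P] lin_onD(3)[OF P])
    moreover have "B \<subseteq> ?S" using BC F.span_base by blast
    ultimately have S: "F.span B \<subseteq> ?S" by (intro F.span_minimal)
    have "?P k x \<in> F.span (?P k ` B)" if x: "x \<in> C k" for x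
    proof -
      let ?y = "?P k x"
      have y: "?y \<in> C k" by (rule lin_onD(1)[OF P x])
      have Hy: "H k ?y \<in> C (k + 1)" by (rule lin_onD(1)[OF H y])
      have Ty: "?T k ?y = ?y - d (k + 1) (H k ?y)"
        using lin_on_zero[OF H closed'(1)] by (simp add: homotopy_map_def[of d H] dP[OF x])
      \<comment> \<open>On the cycle \<open>?y\<close> the map \<open>?T\<close> changes only a
        boundary, which \<open>?P\<close> kills; so \<open>?P k x\<close> is recovered from the
        finite-rank image of \<open>?T\<close>.\<close>
      have "?P k (?T k ?y) = ?P k ?y - ?P k (d (k + 1) (H k ?y))"
        unfolding Ty by (rule lin_on_diff[OF P cc'(2) y lin_onD(1)[OF cc'(5) Hy]])
      then have "?P k (?T k ?y) = ?P k x" by (simp add: PP[OF x] Pd[OF Hy])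
      moreover have "?T k ?y \<in> ?S" using S B(3) y by blast
      ultimately show ?thesis by simp
    qed
    then show ?thesis using \<open>finite B\<close> by (intro exI[of _ "?P k ` B"]) (auto simp: V_def)
  qed
  then have "\<exists>n g. lin_on UNIV coord_scale (\<lambda>c. sc (lconst c)) (free_mod n) (V k) g \<and>
      bij_betw g (free_mod n) (V k) \<and> (V k = {0} \<longrightarrow> n = 0)" for k
    using F.finite_dimensional_coordinates[OF image_subspace[OF P]] unfolding V_def by metis
  then obtain dim g where
    gV: "\<And>k. lin_on UNIV coord_scale (\<lambda>c. sc (lconst c)) (free_mod (dim k)) (V k) (g k)" and
    bij: "\<And>k. bij_betw (g k) (free_mod (dim k)) (V k)" and dim0: "\<And>k. V k = {0} \<Longrightarrow> dim k = 0"
    by metis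
  have VC: "V k \<subseteq> C k" for k using lin_onD(1)[OF P] by (auto simp: V_def)
  have dV: "d k v = 0" and PV: "?P k v = v" if "v \<in> V k" for k v
    using that dP PP by (auto simp: V_def)
  define f where "f k x = the_inv_into (free_mod (dim k)) (g k) (?P k x)" for k x
  have gf: "g k (f k x) = ?P k x" and fD: "f k x \<in> free_mod (dim k)" if x: "x \<in> C k" for k x
  proof -
    have "?P k x \<in> g k ` free_mod (dim k)" using x bij[of k] by (auto simp: V_def bij_betw_def)
    then show "g k (f k x) = ?P k x" "f k x \<in> free_mod (dim k)"
      using f_the_inv_into_f[OF bij_betw_imp_inj_on[OF bij[of k]]]
        the_inv_into_into[OF bij_betw_imp_inj_on[OF bij[of k]] _ order_refl]
      by (simp_all add: f_def)
  qed
  have gVy: "g k y \<in> V k" if "y \<in> free_mod (dim k)" for k y by (rule lin_onD(1)[OF gV that])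
  have fg: "f k (g k y) = y" if "y \<in> free_mod (dim k)" for k y
    using bij[of k] that PV[OF gVy[OF that]] by (simp add: f_def bij_betw_def the_inv_into_f_f)
  have g_inj: "y = y'" if "y \<in> free_mod (dim k)" "y' \<in> free_mod (dim k)" "g k y = g k y'" for k y y'
    using bij[of k] that by (auto simp: bij_betw_def inj_on_def)
  note fm = submod_on_free_mod[where 'r = 'a]
  have f_lin: "lin_on UNIV (\<lambda>c. sc (lconst c)) coord_scale (C k) (free_mod (dim k)) (f k)" for k
    unfolding lin_on_def
  proof (intro conjI ballI)
    fix x assume x: "x \<in> C k"
    show "f k x \<in> free_mod (dim k)" by (rule fD[OF x])
    show "f k (sc (lconst c) x) = coord_scale c (f k x)" for c
    proof (rule g_inj)
      show "g k (f k (sc (lconst c) x)) = g k (coord_scale c (f k x))"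
        using x closed'(5) by (simp add: gf lin_onD(3)[OF gV] fD lin_onD(3)[OF P])
    qed (use x closed'(5) fD submod_on_closed(5)[OF fm] in auto)
    fix y assume y: "y \<in> C k"
    show "f k (x + y) = f k x + f k y"
    proof (rule g_inj)
      show "g k (f k (x + y)) = g k (f k x + f k y)"
        using x y closed'(2) by (simp add: gf lin_onD(2)[OF gV] fD lin_onD(2)[OF P])
    qed (use x y closed'(2) fD submod_on_closed(2)[OF fm] in auto)
  qed
  obtain N where N: "\<And>k. \<bar>k\<bar> > N \<Longrightarrow> C k = {0}" using bd unfolding bounded_complex_def by blast
  have dimN: "\<forall>k. \<bar>k\<bar> > N \<longrightarrow> dim k = 0"
  proof (intro allI impI)
    fix k assume "\<bar>k\<bar> > N"
    then have "C k = {0}" by (rule N)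
    then have "V k = {0}" using lin_on_zero[OF P closed'(1)] by (simp add: V_def)
    then show "dim k = 0" by (rule dim0)
  qed
  have zero_lin: "lin_on UNIV coord_scale coord_scale (free_mod m) (free_mod m') (\<lambda>_. 0 :: nat \<Rightarrow> 'a)" for m m'
    by (auto simp: lin_on_def free_mod_def coord_scale_def)
  have fd: "f (k - 1) (d k x) = 0" if x: "x \<in> C k" for k x
  proof (rule g_inj)
    have dx: "d k x \<in> C (k - 1)" by (rule lin_onD(1)[OF cc'(3) x])
    show "f (k - 1) (d k x) \<in> free_mod (dim (k - 1))" by (rule fD[OF dx])
    show "(0 :: nat \<Rightarrow> 'a) \<in> free_mod (dim (k - 1))" by (rule submod_on_closed(1)[OF fm])
    show "g (k - 1) (f (k - 1) (d k x)) = g (k - 1) 0"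
      using gf[OF dx] Pd[of x "k - 1"] x lin_on_zero[OF gV submod_on_closed(1)[OF fm]] by simp
  qed
  have g_lin: "lin_on UNIV coord_scale (\<lambda>c. sc (lconst c)) (free_mod (dim k)) (C k) (g k)" for k
    using gV[of k] VC[of k] unfolding lin_on_def by blast
  have gd: "g (k - 1) 0 = d k (g k y)" if "y \<in> free_mod (dim k)" for k y
    using lin_on_zero[OF gV submod_on_closed(1)[OF fm]] dV[OF gVy[OF that]] by simp
  have hom: "x - g k (f k x) = d (k + 1) (h k x) + h (k - 1) (d k x)" if "x \<in> C k" for k x
    using gf[OF that] by (simp add: homotopy_map_def)
  show ?thesis
    \<comment> \<open>The target is the homology with zero differential. Since \<open>f\<close>
      after \<open>g\<close> is the identity, the second homotopy is zero, while \<open>h\<close> is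
      the first.\<close>
    unfolding F_finitely_dominated_def Let_def
    by (rule exI[of _ dim], rule exI[of _ "\<lambda>_ _. 0"], rule exI[of _ f], rule exI[of _ g],
        rule exI[of _ h], rule exI[of _ "\<lambda>_ _. 0"])
      (use dimN zero_lin fd f_lin g_lin gd hom fg h in \<open>auto simp: lin_on_lconst_iff\<close>)
qed

end

theorem theorem5p1:
  fixes sc :: "('n::finite, 'a::field) laurent \<Rightarrow> 'm::ab_group_add \<Rightarrow> 'm"
    and C :: "int \<Rightarrow> 'm set" and d :: "int \<Rightarrow> 'm \<Rightarrow> 'm"
  assumes "chain_complex sc C d"
    and "bounded_complex C"
    and "\<forall>k. fg_projective sc (C k)"
  shows "F_finitely_dominated sc C d \<longleftrightarrow> (\<forall>j::'n. tensor_acyclic j sc C d)"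
proof
  assume "F_finitely_dominated sc C d"
  from finitely_dominated_imp_torsion_homology[OF assms(1) this]
  show "\<forall>j::'n. tensor_acyclic j sc C d"
    by (simp add: tensor_acyclic_iff_torsion_homology[OF assms(1)])
next
  assume ac: "\<forall>j::'n. tensor_acyclic j sc C d"
  have proj: "fg_projective sc (C k)" for k using assms(3) by blast
  have "\<forall>j. \<exists>p h. p \<in> laurent_sub j \<and> p \<noteq> 0 \<and> null_homotopic_by sc C d p h"
  proof
    fix j
    have "torsion_homology j sc C d"
      using ac by (simp add: tensor_acyclic_iff_torsion_homology[OF assms(1)])
    then show "\<exists>p h. p \<in> laurent_sub j \<and> p \<noteq> 0 \<and> null_homotopic_by sc C d p h"
      by (rule torsion_homology_imp_null_homotopic[OF assms(1,2) proj]) blast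
  qed
  then obtain p h where p: "\<And>j. p j \<in> laurent_sub j" "\<And>j. p j \<noteq> 0"
    and null: "\<And>j. null_homotopic_by sc C d (p j) (h j)"
    by metis
  \<comment> \<open>With all variables treated, \<open>H\<close> is linear over the constants only,
    and its map kills every multiple of every \<open>p j\<close>.\<close>
  obtain H where H: "\<And>k. lin_on (laurent_free_of UNIV) sc sc (C k) (C (k + 1)) (H k)"
    and kill: "\<And>j k x. x \<in> C k \<Longrightarrow> homotopy_map d H k (sc (p j) x) = 0"
    using homotopy_killing_all_multiples[OF assms(1) proj p null finite_UNIV] by blast
  have "range lconst \<subseteq> laurent_free_of UNIV"
    by (auto simp: laurent_free_of_def lconst_def split: if_splits)
  then have H': "lin_on (range lconst) sc sc (C k) (C (k + 1)) (H k)" for k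
    using lin_on_mono[OF H] by blast
  show "F_finitely_dominated sc C d"
  proof (rule finitely_dominated_if_finite_rank_homotopy[OF assms(1,2) H'])
    show "\<exists>E. finite E \<and> homotopy_map d H k ` C k \<subseteq> module.span (\<lambda>c. sc (lconst c)) E" for k
      by (rule finite_span_of_killed_multiples[OF chain_complexD(1,2)[OF assms(1)] proj
            homotopy_map_lin[OF assms(1) H'] p kill])
  qed
qed

end
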